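(* Let $\Theta\in(0,\pi/2)$, $\ell=\cos\Theta\in(0,1)$, $\ell'=\sqrt{1-\ell^2}$, and let $m\in\mathbb{N}$, $m\ge 1$. Let $M=K(\ell)/K(\lambda)$, where $\lambda\in(0,1)$ is determined uniquely by the condition that $$\frac{K(\ell)}{K(\ell')}=\frac{K(\lambda)}{mK(\lambda')},\qquad \lambda'=\sqrt{1-\lambda^2}.$$ Then the rational function $$s(z)=i^{1-m}\prod_{j=1}^m\frac{z-ib_j}{1+ib_jz},\qquad b_j=(-1)^{mj}\left(\frac{\ell\,\mathrm{sn}\left(\frac{2j-1}{m}K(\ell'),\ell'\right)+\mathrm{dn}\left(\frac{2j-1}{m}K(\ell'),\ell'\right)}{\mathrm{cn}\left(\frac{2j-1}{m}K(\ell'),\ell'\right)}\right)^{(-1)^j},$$ can be expressed as $$s(z)=F(x)+i\,\mathrm{sign}(\operatorname{Im}z)^m\,G(x),\qquad x=\tfrac12(z+z^{-1}),$$ where $$F(x)=\lambda\,\mathrm{sn}\left(\frac{\mathrm{sn}^{-1}(x/\ell,\ell)}{M},\lambda\right),\qquad G(x)=\mathrm{dn}\left(\frac{\mathrm{sn}^{-1}(x/\ell,\ell)}{M},\lambda\right).$$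
   Context: $\mathrm{sn}(\cdot,k),\mathrm{cn}(\cdot,k),\mathrm{dn}(\cdot,k)$ are Jacobi's elliptic functions with modulus $k$ (not parameter $k^2$), and $K(k)=\int_0^{\pi/2}(1-k^2\sin^2\theta)^{-1/2}\,d\theta$. Convention for $b_j$: when $m=2k+1$ is odd and $j=k+1$, $\mathrm{cn}(\frac{2j-1}{m}K(\ell'),\ell')=0$, so $b_j=0$ if $k$ is even and $b_j=\infty$ if $k$ is odd; when $b_j=\infty$ the factor $\frac{z-ib_j}{1+ib_jz}$ is understood as its limit $-1/z$. Branch convention: $u=\mathrm{sn}^{-1}(x/\ell,\ell)$ denotes any $u$ with $\mathrm{sn}(u,\ell)=x/\ell$ for which $\mathrm{dn}(u,\ell)$ equals the square root of $1-x^2$ with nonnegative real part, i.e. $\mathrm{dn}(u,\ell)=\frac{1}{2i}(z-z^{-1})\,\mathrm{sign}(\operatorname{Im}z)$ when $x=\frac12(z+z^{-1})$ and $\operatorname{Im} z\neq 0$ (the values $F(x),G(x)$ do not depend on the choice of such $u$). For real $t\neq0$, $\mathrm{sign}(t)=\pm1$ is the usual sign; $\mathrm{sign}(\operatorname{Im}z)^m$ is read as $1$ for all $z$ when $m$ is even. The identity is one of meromorphic functions of $z$: for $m$ even on all of $\mathbb{C}$; for $m$ odd on $\mathbb{C}\setminus\mathbb{R}$, and also at $z=\pm1$ (where $G(x)=0$). In particular it holds on the whole unit circle $|z|=1$. *)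

theory Defs
  imports "HOL-Complex_Analysis.Complex_Analysis"
begin

section \<open>Elliptic integrals and Jacobi's elliptic functions (modulus \<open>k\<close>, not parameter \<open>k\<^sup>2\<close>)\<close>

definition ellipF :: "real \<Rightarrow> real \<Rightarrow> real" where
  "ellipF k \<phi> = integral {0..\<phi>} (\<lambda>\<theta>. 1 / sqrt (1 - k\<^sup>2 * (sin \<theta>)\<^sup>2))"

definition ellipK :: "real \<Rightarrow> real" where
  "ellipK k = ellipF k (pi / 2)"

text \<open>
  Jacobi's functions invert the elliptic integral of the first kind: for \<open>u = ellipF k \<phi>\<close> one has
  \<open>sn u = sin \<phi>\<close>, \<open>cn u = cos \<phi>\<close> and \<open>dn u = sqrt (1 - k\<^sup>2 sin\<^sup>2 \<phi>)\<close>. On the complex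
  plane they are the meromorphic continuations of these real functions; a continuation is
  already determined by its values at real \<open>u \<ge> 0\<close>. Being nicely meromorphic fixes the value
  at each pole to be 0, so that the continuation is unique as a HOL function. Only moduli
  with \<open>0 < k < 1\<close> are used.
\<close>

definition inversion_of_ellipF :: "real \<Rightarrow> (real \<Rightarrow> real) \<Rightarrow> complex \<Rightarrow> complex" where
  "inversion_of_ellipF k g =
     (THE f. f nicely_meromorphic_on UNIV \<and>
             (\<forall>\<phi>\<ge>0. f (of_real (ellipF k \<phi>)) = of_real (g \<phi>)))"

definition jacobi_sn :: "real \<Rightarrow> complex \<Rightarrow> complex" where
  "jacobi_sn k = inversion_of_ellipF k sin"

definition jacobi_cn :: "real \<Rightarrow> complex \<Rightarrow> complex" where
  "jacobi_cn k = inversion_of_ellipF k cos"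

definition jacobi_dn :: "real \<Rightarrow> complex \<Rightarrow> complex" where
  "jacobi_dn k = inversion_of_ellipF k (\<lambda>\<phi>. sqrt (1 - k\<^sup>2 * (sin \<phi>)\<^sup>2))"


section \<open>The functions \<open>F\<close> and \<open>G\<close>\<close>

text \<open>
  \<open>u\<close> is an admissible value of \<open>sn\<^sup>-\<^sup>1 (x/\<ell>, \<ell>)\<close>: \<open>dn (u, \<ell>)\<close> has to be a square root of
  \<open>1 - x\<^sup>2\<close> with nonnegative real part (for real \<open>x\<close> with \<open>\<bar>x\<bar> > 1\<close> both roots qualify).
\<close>

definition is_arc_sn :: "real \<Rightarrow> complex \<Rightarrow> complex \<Rightarrow> bool" where
  "is_arc_sn l x u \<longleftrightarrow>
     \<not> is_pole (jacobi_sn l) u \<and> jacobi_sn l u = x / of_real l \<and>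
     (jacobi_dn l u)\<^sup>2 = 1 - x\<^sup>2 \<and> Re (jacobi_dn l u) \<ge> 0"

definition arc_sn :: "real \<Rightarrow> complex \<Rightarrow> complex" where
  "arc_sn l x = (SOME u. is_arc_sn l x u)"

definition F_fun :: "real \<Rightarrow> real \<Rightarrow> real \<Rightarrow> complex \<Rightarrow> complex" where
  "F_fun l lam M x = of_real lam * jacobi_sn lam (arc_sn l x / of_real M)"

definition G_fun :: "real \<Rightarrow> real \<Rightarrow> real \<Rightarrow> complex \<Rightarrow> complex" where
  "G_fun l lam M x = jacobi_dn lam (arc_sn l x / of_real M)"

definition modulus_eq :: "real \<Rightarrow> nat \<Rightarrow> real \<Rightarrow> bool" where
  "modulus_eq l m lam \<longleftrightarrow> 0 < lam \<and> lam < 1 \<and>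
     ellipK l / ellipK (sqrt (1 - l\<^sup>2)) = ellipK lam / (real m * ellipK (sqrt (1 - lam\<^sup>2)))"

definition joukowski :: "complex \<Rightarrow> complex" where
  "joukowski z = (z + inverse z) / 2"

definition sign_pow :: "nat \<Rightarrow> complex \<Rightarrow> complex" where
  "sign_pow m z = (if even m then 1 else of_real (sgn (Im z) ^ m))"


section \<open>The rational function \<open>s\<close>\<close>

text \<open>
  For the middle index of an odd \<open>m\<close>, \<open>2 j = m + 1\<close>, the function \<open>cn\<close> vanishes. If \<open>j\<close> is odd,
  the outer exponent is \<open>-1\<close> and \<open>b\<^sub>j = 0\<close>. If \<open>j\<close> is even, \<open>b\<^sub>j = \<infinity>\<close>; this case is dealt with in
  \<open>s_factor\<close>, which then is the limit \<open>-1/z\<close>, and the value of \<open>b_coeff\<close> is not used.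
\<close>

definition b_coeff :: "real \<Rightarrow> nat \<Rightarrow> nat \<Rightarrow> complex" where
  "b_coeff l m j =
     (let l' = sqrt (1 - l\<^sup>2);
          t = of_real ((2 * real j - 1) / real m * ellipK l')
      in if 2 * j = m + 1 then 0
         else (-1) ^ (m * j) *
              ((of_real l * jacobi_sn l' t + jacobi_dn l' t) / jacobi_cn l' t) powi ((-1) ^ j))"

definition s_factor :: "real \<Rightarrow> nat \<Rightarrow> nat \<Rightarrow> complex \<Rightarrow> complex" where
  "s_factor l m j z =
     (if 2 * j = m + 1 \<and> even j then - 1 / z
      else (z - \<i> * b_coeff l m j) / (1 + \<i> * b_coeff l m j * z))"

definition s_fun :: "real \<Rightarrow> nat \<Rightarrow> complex \<Rightarrow> complex" where
  "s_fun l m z = \<i> powi (1 - int m) * (\<Prod>j=1..m. s_factor l m j z)"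

end

theory Submission
  imports Defs
begin

text \<open>
  Write \<open>Z\<^sub>k(u) = k sn(u,k) + i dn(u,k)\<close>. Since \<open>k\<^sup>2 sn\<^sup>2 + dn\<^sup>2 = 1\<close>, its reciprocal is
  \<open>k sn - i dn\<close>. If \<open>x = \<ell> sn(u,\<ell>)\<close> and \<open>dn(u,\<ell>)\<close> has nonnegative real part, then a solution \<open>z\<close>
  of \<open>x = (z + 1/z)/2\<close> with \<open>Im z \<ge> 0\<close> is \<open>Z\<^sub>\<ell>(u)\<close>, while \<open>F(x) + i G(x)\<close> is \<open>Z\<^sub>\<lambda>(u/M)\<close>. In the
  upper half plane the theorem therefore says
  \<open>s(Z\<^sub>\<ell>(u)) = Z\<^sub>\<lambda>(u/M)\<close> (\<open>s_fun_sndn\<close>).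

  Both sides have the periods \<open>4K(\<ell>)\<close> and \<open>4iK(\<ell>')\<close>: the equation that defines \<open>\<lambda>\<close> says precisely that
  \<open>u \<mapsto> u/M\<close> maps \<open>K(\<ell>)\<close> to \<open>K(\<lambda>)\<close> and \<open>iK(\<ell>')\<close> to \<open>m i K(\<lambda>')\<close> (\<open>compl_period\<close>). On the line
  \<open>Re u = 0\<close> the function \<open>Z\<^sub>\<ell>\<close> is \<open>i\<close> times a real function, called \<open>axis_val\<close> below, which is
  injective modulo \<open>4K(\<ell>')\<close>. The numbers \<open>b\<^sub>j\<close> are the values of \<open>axis_val\<close> at the \<open>m\<close> points
  \<open>N K(\<ell>')/m\<close> with \<open>N\<close> congruent to \<open>-1\<close> modulo 4 (\<open>s_factor_eq_mobius\<close>), and these points are the zeros of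
  \<open>Z\<^sub>\<lambda>(u/M)\<close> on this line, up to periods (\<open>on_axis_nodes\<close>). The lines \<open>Re u = 2nK(\<ell>)\<close> behave in the same way, with
  \<open>(-1)\<^sup>n Im u\<close> in place of \<open>Im u\<close>, and all other zeros and poles lie on them. Hence the two sides have the same zeros and poles,
  all of them simple; their quotient is constant by Liouville's theorem, and it is 1 because both sides
  are \<open>i\<close> at \<open>u = 0\<close> (\<open>s_pullback_eq_sndn_rescaled_eventually\<close>).

  The lower half plane follows from \<open>Z\<^sub>k(u + 2iK(k')) = 1/Z\<^sub>k(u)\<close>: a shift of \<open>u\<close> by \<open>2iK(\<ell>')\<close> replaces
  \<open>z\<close> by \<open>1/z\<close>, and it shifts \<open>u/M\<close> by \<open>m\<close> times \<open>2iK(\<lambda>')\<close>, so that \<open>s(1/z)\<close> is \<open>s(z)\<close> for even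
  \<open>m\<close> and \<open>1/s(z)\<close> for odd \<open>m\<close> (\<open>s_fun_inverse\<close>).

  The meromorphic functions themselves are obtained without series. The addition theorem and Jacobi's
  imaginary transformation express \<open>Z\<^sub>k(x + iy)\<close> through the real functions of \<open>x\<close> with modulus \<open>k\<close>
  and of \<open>y\<close> with modulus \<open>k'\<close>; after a cancellation this expression is the quotient \<open>sndn\<close>. It
  is taken as a definition, and the Cauchy-Riemann equations are verified. Then \<open>sn\<close>, \<open>dn\<close>
  and \<open>cn\<close> are \<open>(Z + 1/Z)/(2k)\<close>, \<open>(Z - 1/Z)/(2i)\<close> and \<open>i Z'/(k Z)\<close>.

  As division by zero gives zero, \<open>sndn\<close> and its inverse both have the value 0 at every zero
  and at every pole of \<open>Z\<^sub>k\<close>. These are the poles of \<open>sn\<close> and \<open>dn\<close>, where the normalized continuations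
  have the value 0 too. In the same way \<open>s_fun\<close> has the value 0 exactly at its zeros and poles. So
  the identities between \<open>s\<close>, \<open>sn\<close>, \<open>dn\<close> and \<open>sndn\<close> hold at the poles as well, and no case distinction
  is needed when they are combined.
\<close>

section \<open>The amplitude and Jacobi's functions of a real argument\<close>

definition compl_mod :: "real \<Rightarrow> real" where
  "compl_mod k = sqrt (1 - k\<^sup>2)"

lemma compl_mod_pos:
  assumes "0 < k" "k < 1"
  shows "0 < compl_mod k" "compl_mod k < 1"
  using assms by (auto simp: compl_mod_def abs_square_less_1)

lemma compl_mod_power2:
  assumes "0 < k" "k < 1"
  shows "(compl_mod k)\<^sup>2 = 1 - k\<^sup>2"
  using assms by (simp add: compl_mod_def power_le_one)

lemma compl_mod_compl_mod:
  assumes "0 < k" "k < 1"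
  shows "compl_mod (compl_mod k) = k"
  using assms by (simp add: compl_mod_def power_le_one)

definition delta :: "real \<Rightarrow> real \<Rightarrow> real" where
  "delta k \<theta> = sqrt (1 - k\<^sup>2 * (sin \<theta>)\<^sup>2)"

lemma delta_radicand_pos:
  fixes k \<theta> :: real
  assumes "0 < k" "k < 1"
  shows "0 < 1 - k\<^sup>2 * (sin \<theta>)\<^sup>2"
proof -
  have "k\<^sup>2 * (sin \<theta>)\<^sup>2 \<le> k\<^sup>2 * 1"
    by (intro mult_left_mono) (simp_all add: abs_square_le_1)
  moreover have "k\<^sup>2 < 1"
    using assms by (simp add: abs_square_less_1)
  ultimately show ?thesis by linarith
qed

lemma delta_pos:
  assumes "0 < k" "k < 1"
  shows "0 < delta k \<theta>"
  using delta_radicand_pos[OF assms] by (simp add: delta_def)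

lemma delta_power2:
  assumes "0 < k" "k < 1"
  shows "(delta k \<theta>)\<^sup>2 = 1 - k\<^sup>2 * (sin \<theta>)\<^sup>2"
  using delta_radicand_pos[OF assms, of \<theta>] by (simp add: delta_def)

lemma delta_le_1: "delta k \<theta> \<le> 1"
  by (simp add: delta_def)

text \<open>
  The integral over an interval with negative right end point is 0, so \<open>ellipF k\<close> is not injective;
  its odd extension is a bijection of the real line.
\<close>

definition ellipF_odd :: "real \<Rightarrow> real \<Rightarrow> real" where
  "ellipF_odd k \<phi> = (if \<phi> \<ge> 0 then ellipF k \<phi> else - ellipF k (- \<phi>))"

lemma ellipF_odd_deriv:
  assumes k: "0 < k" "k < 1"
  shows "(ellipF_odd k has_real_derivative 1 / delta k \<phi>) (at \<phi>)"
proof -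
  have cont: "isCont (\<lambda>\<theta>. 1 / delta k \<theta>) x" for x
  proof -
    have "delta k x \<noteq> 0" using delta_pos[OF k, of x] by linarith
    moreover have "isCont (delta k) x" unfolding delta_def[abs_def] by (intro continuous_intros)
    ultimately show ?thesis by (intro continuous_intros)
  qed
  obtain G where G: "\<And>x. (G has_real_derivative 1 / delta k x) (at x)"
    using einterval_antiderivative[of "-\<infinity>" \<infinity> "\<lambda>\<theta>. 1 / delta k \<theta>"] cont
    by (auto simp: has_real_derivative_iff_has_vector_derivative)
  have *: "ellipF k x = G x - G 0" if "x \<ge> 0" for x
    unfolding ellipF_def
    by (rule integral_unique, rule fundamental_theorem_of_calculus)
       (use that G in \<open>auto simp: delta_def[symmetric] has_real_derivative_iff_has_vector_derivative
          intro: has_vector_derivative_at_within\<close>)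
  have "((\<lambda>x. G x + G (- x)) has_real_derivative 0) (at x)" for x
    by (rule derivative_eq_intros DERIV_chain'[OF _ G] G refl | simp)+ (simp add: delta_def)
  then have "G x + G (- x) = G 0 + G (- 0)" for x
    using DERIV_isconst_all by blast
  then have **: "G (- x) = 2 * G 0 - G x" for x
    by (simp add: algebra_simps)
  have "ellipF_odd k = (\<lambda>x. G x - G 0)"
    by (rule ext) (auto simp: ellipF_odd_def * **)
  then show ?thesis
    by (auto intro!: derivative_eq_intros G)
qed

lemma ellipF_odd_minus: "ellipF_odd k (- \<phi>) = - ellipF_odd k \<phi>"
  by (auto simp: ellipF_odd_def ellipF_def)

lemma ellipF_odd_0 [simp]: "ellipF_odd k 0 = 0"
  by (simp add: ellipF_odd_def ellipF_def)

text \<open>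
  The derivative is at least 1. This gives injectivity and surjectivity, and it makes the inverse
  function a contraction, hence continuous.
\<close>

lemma ellipF_odd_expands:
  assumes k: "0 < k" "k < 1" and "a < b"
  shows "b - a \<le> ellipF_odd k b - ellipF_odd k a"
proof -
  have "\<exists>z>a. z < b \<and> ellipF_odd k b - ellipF_odd k a = (b - a) * (1 / delta k z)"
    using MVT2[OF \<open>a < b\<close> ellipF_odd_deriv[OF k]] by blast
  then obtain z where z: "ellipF_odd k b - ellipF_odd k a = (b - a) * (1 / delta k z)"
    by blast
  have "1 \<le> 1 / delta k z"
    using delta_pos[OF k, of z] delta_le_1[of k z] by simp
  then have "(b - a) * 1 \<le> (b - a) * (1 / delta k z)"
    using \<open>a < b\<close> by (intro mult_left_mono) auto
  then show ?thesis using z by simp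
qed

lemma ellipF_odd_cont:
  assumes k: "0 < k" "k < 1"
  shows "isCont (ellipF_odd k) x"
  using ellipF_odd_deriv[OF k] DERIV_isCont by blast

lemma bij_ellipF_odd:
  assumes k: "0 < k" "k < 1"
  shows "bij (ellipF_odd k)"
proof (rule bijI)
  show "inj (ellipF_odd k)"
  proof (rule linorder_injI)
    fix x y :: real assume "x < y"
    then show "ellipF_odd k x \<noteq> ellipF_odd k y"
      using ellipF_odd_expands[OF k, of x y] by linarith
  qed
  show "surj (ellipF_odd k)"
    unfolding surj_def
  proof
    fix y
    have 1: "ellipF_odd k \<bar>y\<bar> \<ge> \<bar>y\<bar>"
      using ellipF_odd_expands[OF k, of 0 "\<bar>y\<bar>"] by (cases "y = 0") auto
    moreover have "ellipF_odd k (- \<bar>y\<bar>) \<le> - \<bar>y\<bar>"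
      using 1 ellipF_odd_minus[of k "\<bar>y\<bar>"] by simp
    ultimately have "\<exists>x\<ge>- \<bar>y\<bar>. x \<le> \<bar>y\<bar> \<and> ellipF_odd k x = y"
      by (intro IVT) (auto simp: ellipF_odd_cont[OF k])
    then show "\<exists>x. y = ellipF_odd k x" by blast
  qed
qed

definition am :: "real \<Rightarrow> real \<Rightarrow> real" where
  "am k = inv (ellipF_odd k)"

lemma ellipF_odd_am:
  assumes k: "0 < k" "k < 1"
  shows "ellipF_odd k (am k x) = x"
  unfolding am_def using bij_ellipF_odd[OF k] by (simp add: bij_def surj_f_inv_f)

lemma am_ellipF_odd:
  assumes k: "0 < k" "k < 1"
  shows "am k (ellipF_odd k x) = x"
  unfolding am_def using bij_ellipF_odd[OF k] by (simp add: bij_def)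

lemma am_eqI:
  assumes k: "0 < k" "k < 1" and "ellipF_odd k y = x"
  shows "am k x = y"
  using assms am_ellipF_odd by blast

lemma am_deriv:
  assumes k: "0 < k" "k < 1"
  shows "(am k has_real_derivative delta k (am k x)) (at x)"
proof -
  have lip: "\<bar>am k y - am k x\<bar> \<le> \<bar>y - x\<bar>" for y
    using ellipF_odd_expands[OF k, of "am k y" "am k x"] ellipF_odd_expands[OF k, of "am k x" "am k y"]
      ellipF_odd_am[OF k] by (cases "am k y" "am k x" rule: linorder_cases) auto
  have "isCont (am k) x"
    unfolding isCont_def
  proof (rule LIM_I)
    fix r :: real assume "r > 0"
    then show "\<exists>s>0. \<forall>y. y \<noteq> x \<and> norm (y - x) < s \<longrightarrow> norm (am k y - am k x) < r"
      using lip by (intro exI[of _ r]) (auto intro: le_less_trans)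
  qed
  then have "(am k has_real_derivative inverse (1 / delta k (am k x))) (at x)"
    using delta_pos[OF k, of "am k x"]
    by (intro DERIV_inverse_function[where f = "ellipF_odd k" and a = "x - 1" and b = "x + 1"])
       (auto simp: ellipF_odd_am[OF k] intro: ellipF_odd_deriv[OF k])
  then show ?thesis by simp
qed

definition rsn :: "real \<Rightarrow> real \<Rightarrow> real" where "rsn k x = sin (am k x)"
definition rcn :: "real \<Rightarrow> real \<Rightarrow> real" where "rcn k x = cos (am k x)"
definition rdn :: "real \<Rightarrow> real \<Rightarrow> real" where "rdn k x = delta k (am k x)"

lemma rsn_rcn: "(rcn k x)\<^sup>2 = 1 - (rsn k x)\<^sup>2"
  by (simp add: rsn_def rcn_def cos_squared_eq)

lemma rdn_power2:
  assumes "0 < k" "k < 1"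
  shows "(rdn k x)\<^sup>2 = 1 - k\<^sup>2 * (rsn k x)\<^sup>2"
  using assms by (simp add: rdn_def rsn_def delta_power2)

lemma rdn_pos:
  assumes "0 < k" "k < 1"
  shows "0 < rdn k x"
  using assms by (simp add: rdn_def delta_pos)

lemma rsn_deriv:
  assumes k: "0 < k" "k < 1"
  shows "(rsn k has_real_derivative rcn k x * rdn k x) (at x)"
  unfolding rsn_def[abs_def] rcn_def rdn_def
  by (auto intro!: derivative_eq_intros am_deriv[OF k])

lemma rcn_deriv:
  assumes k: "0 < k" "k < 1"
  shows "(rcn k has_real_derivative - rsn k x * rdn k x) (at x)"
  unfolding rcn_def[abs_def] rsn_def rdn_def
  by (auto intro!: derivative_eq_intros am_deriv[OF k])

lemma rdn_deriv:
  assumes k: "0 < k" "k < 1"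
  shows "(rdn k has_real_derivative - k\<^sup>2 * rsn k x * rcn k x) (at x)"
proof -
  have eq: "rdn k = (\<lambda>x. sqrt (1 - k\<^sup>2 * (rsn k x)\<^sup>2))"
    by (rule ext) (simp add: rdn_def delta_def rsn_def)
  have "0 < 1 - k\<^sup>2 * (rsn k x)\<^sup>2"
    using delta_radicand_pos[OF k, of "am k x"] by (simp add: rsn_def)
  then have "((\<lambda>x. sqrt (1 - k\<^sup>2 * (rsn k x)\<^sup>2)) has_real_derivative
      (- (k\<^sup>2 * (2 * rsn k x * (rcn k x * rdn k x)))) * (inverse (sqrt (1 - k\<^sup>2 * (rsn k x)\<^sup>2)) / 2)) (at x)"
    by (auto intro!: derivative_eq_intros rsn_deriv[OF k])
  also have "inverse (sqrt (1 - k\<^sup>2 * (rsn k x)\<^sup>2)) = inverse (rdn k x)"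
    by (simp add: eq)
  also have "(- (k\<^sup>2 * (2 * rsn k x * (rcn k x * rdn k x)))) * (inverse (rdn k x) / 2) = - k\<^sup>2 * rsn k x * rcn k x"
    using rdn_pos[OF k, of x] by simp
  finally show ?thesis
    unfolding eq[symmetric] .
qed

lemma ellipF_odd_half_pi: "ellipF_odd k (pi / 2) = ellipK k"
  by (simp add: ellipF_odd_def ellipK_def)

lemma ellipK_pos:
  assumes k: "0 < k" "k < 1"
  shows "0 < ellipK k"
  using ellipF_odd_expands[OF k, of 0 "pi / 2"] pi_gt_zero by (simp add: ellipF_odd_half_pi del: pi_gt_zero)

text \<open>
  The integrand has period \<open>\<pi>\<close>, so the increment over a period is constant; it is computed at
  \<open>\<phi> = -\<pi>/2\<close>, where the interval is symmetric about 0.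
\<close>

lemma ellipF_odd_add_pi:
  assumes k: "0 < k" "k < 1"
  shows "ellipF_odd k (\<phi> + pi) = ellipF_odd k \<phi> + 2 * ellipK k"
proof -
  have "((\<lambda>x. ellipF_odd k (x + pi) - ellipF_odd k x) has_real_derivative 0) (at x)" for x
    by (rule derivative_eq_intros DERIV_chain'[OF _ ellipF_odd_deriv[OF k]] ellipF_odd_deriv[OF k] refl | simp)+
       (simp add: delta_def)
  then have "ellipF_odd k (\<phi> + pi) - ellipF_odd k \<phi> = ellipF_odd k (- (pi/2) + pi) - ellipF_odd k (- (pi/2))"
    using DERIV_isconst_all by blast
  also have "\<dots> = 2 * ellipK k"
    by (simp add: ellipF_odd_minus ellipF_odd_half_pi)
  finally show ?thesis by simp
qed

lemma am_add_2K:
  assumes k: "0 < k" "k < 1"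
  shows "am k (x + 2 * ellipK k) = am k x + pi"
  by (rule am_eqI[OF k]) (simp add: ellipF_odd_add_pi[OF k] ellipF_odd_am[OF k])

lemma am_minus:
  assumes k: "0 < k" "k < 1"
  shows "am k (- x) = - am k x"
  by (rule am_eqI[OF k]) (simp add: ellipF_odd_minus ellipF_odd_am[OF k])

lemma am_0 [simp]: "0 < k \<Longrightarrow> k < 1 \<Longrightarrow> am k 0 = 0"
  by (rule am_eqI) auto

lemma am_K [simp]: "0 < k \<Longrightarrow> k < 1 \<Longrightarrow> am k (ellipK k) = pi / 2"
  by (rule am_eqI) (auto simp: ellipF_odd_half_pi)

lemma am_add_int:
  assumes k: "0 < k" "k < 1"
  shows "am k (x + 2 * ellipK k * of_int n) = am k x + pi * of_int n"
proof -
  have nat: "am k (x + 2 * ellipK k * real i) = am k x + pi * real i" for x and i :: nat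
  proof (induction i)
    case (Suc i)
    have "x + 2 * ellipK k * real (Suc i) = (x + 2 * ellipK k * real i) + 2 * ellipK k"
      by (simp add: algebra_simps)
    then show ?case
      using Suc am_add_2K[OF k, of "x + 2 * ellipK k * real i"] by (simp add: algebra_simps)
  qed simp
  show ?thesis
  proof (cases "n \<ge> 0")
    case True
    then show ?thesis using nat[of x "nat n"] by simp
  next
    case False
    then show ?thesis using nat[of "x + 2 * ellipK k * of_int n" "nat (- n)"] by simp
  qed
qed

lemma rsn_0 [simp]: "0 < k \<Longrightarrow> k < 1 \<Longrightarrow> rsn k 0 = 0"
  and rcn_0 [simp]: "0 < k \<Longrightarrow> k < 1 \<Longrightarrow> rcn k 0 = 1"
  and rdn_0 [simp]: "0 < k \<Longrightarrow> k < 1 \<Longrightarrow> rdn k 0 = 1"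
  by (auto simp: rsn_def rcn_def rdn_def delta_def)

lemma rsn_minus [simp]: "0 < k \<Longrightarrow> k < 1 \<Longrightarrow> rsn k (- x) = - rsn k x"
  and rcn_minus [simp]: "0 < k \<Longrightarrow> k < 1 \<Longrightarrow> rcn k (- x) = rcn k x"
  and rdn_minus [simp]: "0 < k \<Longrightarrow> k < 1 \<Longrightarrow> rdn k (- x) = rdn k x"
  by (auto simp: rsn_def rcn_def rdn_def delta_def am_minus)

lemma rsn_add_2K: "0 < k \<Longrightarrow> k < 1 \<Longrightarrow> rsn k (x + 2 * ellipK k) = - rsn k x"
  and rcn_add_2K: "0 < k \<Longrightarrow> k < 1 \<Longrightarrow> rcn k (x + 2 * ellipK k) = - rcn k x"
  and rdn_add_2K: "0 < k \<Longrightarrow> k < 1 \<Longrightarrow> rdn k (x + 2 * ellipK k) = rdn k x"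
  by (auto simp: rsn_def rcn_def rdn_def delta_def am_add_2K)

lemma rsn_add_4K: "0 < k \<Longrightarrow> k < 1 \<Longrightarrow> rsn k (x + 4 * ellipK k * of_int n) = rsn k x"
  and rcn_add_4K: "0 < k \<Longrightarrow> k < 1 \<Longrightarrow> rcn k (x + 4 * ellipK k * of_int n) = rcn k x"
  and rdn_add_4K: "0 < k \<Longrightarrow> k < 1 \<Longrightarrow> rdn k (x + 4 * ellipK k * of_int n) = rdn k x"
proof -
  assume k: "0 < k" "k < 1"
  have "am k (x + 4 * ellipK k * of_int n) = am k x + 2 * pi * of_int n"
    using am_add_int[OF k, of x "2 * n"] by (simp add: algebra_simps)
  then show "rsn k (x + 4 * ellipK k * of_int n) = rsn k x"
    "rcn k (x + 4 * ellipK k * of_int n) = rcn k x"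
    "rdn k (x + 4 * ellipK k * of_int n) = rdn k x"
    by (auto simp: rsn_def rcn_def rdn_def delta_def sin_add cos_add sin_int_2pin cos_int_2pin)
qed

lemma am_eq_imp:
  assumes k: "0 < k" "k < 1" and "am k x = am k y + pi * of_int n"
  shows "x = y + 2 * ellipK k * of_int n"
proof -
  have "am k x = am k (y + 2 * ellipK k * of_int n)"
    using assms am_add_int by simp
  then show ?thesis using ellipF_odd_am[OF k] by metis
qed

lemma rsn_eq_0_imp:
  assumes k: "0 < k" "k < 1" and "rsn k x = 0"
  obtains n :: int where "x = 2 * ellipK k * of_int n"
proof -
  obtain n :: int where "am k x = pi * of_int n"
    using assms(3) by (auto simp: rsn_def sin_zero_iff_int2 mult.commute)
  then show ?thesis using am_eq_imp[OF k, of x 0 n] that k by auto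
qed

lemma rsn_rcn_inj:
  assumes k: "0 < k" "k < 1" and "rsn k x = rsn k y" "rcn k x = rcn k y"
  obtains n :: int where "x = y + 4 * ellipK k * of_int n"
proof -
  obtain n :: int where "am k x = am k y + 2 * pi * of_int n"
    using assms(3,4) sin_cos_eq_iff[of "am k x" "am k y"] by (auto simp: rsn_def rcn_def mult_ac)
  then show ?thesis using am_eq_imp[OF k, of x y "2 * n"] that[of n] by (auto simp: algebra_simps)
qed

section \<open>Complete elliptic integrals and the modulus \<open>\<lambda>\<close>\<close>

definition modulus_ratio :: "real \<Rightarrow> real" where
  "modulus_ratio k = ellipK k / ellipK (compl_mod k)"

lemma ellipK_eq: "ellipK k = integral {0..pi/2} (\<lambda>\<theta>. 1 / delta k \<theta>)"
  by (simp add: ellipK_def ellipF_def delta_def)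

lemma ellipK_strict_mono:
  assumes k: "0 < k" "k < k'" "k' < 1"
  shows "ellipK k < ellipK k'"
proof -
  have kk: "0 < k" "k < 1" and kk': "0 < k'" "k' < 1" using k by auto
  define D where "D = (\<lambda>x. ellipF_odd k x - ellipF_odd k' x)"
  have "D 0 > D (pi / 2)"
  proof (rule DERIV_neg_imp_decreasing_open[where f = D])
    show "0 < pi / 2" by simp
    fix x :: real assume x: "0 < x" "x < pi/2"
    have "delta k' x < delta k x"
    proof -
      have "sin x > 0" using x by (intro sin_gt_zero) auto
      moreover have "k\<^sup>2 < k'\<^sup>2" using k by (intro power_strict_mono) auto
      ultimately show ?thesis by (simp add: delta_def)
    qed
    then have "1 / delta k x - 1 / delta k' x < 0"
      using delta_pos[OF kk', of x] by (simp add: frac_less2)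
    moreover have "(D has_real_derivative 1 / delta k x - 1 / delta k' x) (at x)"
      unfolding D_def by (intro derivative_intros ellipF_odd_deriv kk kk')
    ultimately show "\<exists>y. (D has_real_derivative y) (at x) \<and> y < 0"
      by blast
  next
    show "continuous_on {0..pi/2} D"
      unfolding D_def by (intro continuous_at_imp_continuous_on ballI continuous_intros ellipF_odd_cont kk kk')
  qed
  then show ?thesis by (simp add: D_def ellipF_odd_half_pi)
qed

lemma compl_mod_strict_antimono:
  assumes "0 < k" "k < k'" "k' < 1"
  shows "compl_mod k' < compl_mod k"
  using assms by (auto simp: compl_mod_def intro: power_strict_mono)

text \<open>
  The numerator increases with \<open>k\<close>, and the denominator decreases since \<open>k'\<close> does.
\<close>

lemma modulus_ratio_strict_mono:
  assumes k: "0 < k" "k < k'" "k' < 1"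
  shows "modulus_ratio k < modulus_ratio k'"
proof -
  have kk: "0 < k" "k < 1" and kk': "0 < k'" "k' < 1" using k by auto
  show ?thesis
    unfolding modulus_ratio_def
    by (intro frac_less ellipK_strict_mono[OF k] less_imp_le[OF ellipK_strict_mono] compl_mod_strict_antimono[OF k]
        ellipK_pos less_imp_le[OF ellipK_pos] compl_mod_pos kk kk')
qed

lemma ellipK_continuous: "continuous_on {0<..<1} ellipK"
proof -
  have "continuous_on ({0<..<1} \<times> cbox 0 (pi/2)) (\<lambda>(k, \<theta>). 1 / delta k \<theta>)"
    unfolding case_prod_unfold
  proof (intro continuous_on_divide ballI)
    show "continuous_on ({0<..<1} \<times> cbox 0 (pi/2)) (\<lambda>x. delta (fst x) (snd x))"
      unfolding delta_def by (intro continuous_intros)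
    fix x :: "real \<times> real" assume "x \<in> {0<..<1} \<times> cbox 0 (pi/2)"
    then have "0 < fst x" "fst x < 1" by (auto simp: mem_Times_iff)
    then show "delta (fst x) (snd x) \<noteq> 0" using delta_pos by (simp add: less_imp_neq[symmetric])
  qed (rule continuous_on_const)
  from integral_continuous_on_param[OF this] show ?thesis
    by (simp add: ellipK_eq[abs_def])
qed

lemma modulus_ratio_continuous: "continuous_on {0<..<1} modulus_ratio"
  unfolding modulus_ratio_def
proof (intro continuous_intros ellipK_continuous)
  show "continuous_on {0<..<1} (\<lambda>k. ellipK (compl_mod k))"
  proof (rule continuous_on_compose2[OF ellipK_continuous])
    show "continuous_on {0<..<1} compl_mod"
      unfolding compl_mod_def[abs_def] by (intro continuous_intros)
  qed (auto simp: compl_mod_pos)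
  show "\<forall>k\<in>{0<..<1}. ellipK (compl_mod k) \<noteq> 0"
    using ellipK_pos compl_mod_pos by fastforce
qed

text \<open>
  With \<open>t = \<pi>/2 - \<theta>\<close> and \<open>h = k'\<close> the radicand is \<open>h\<^sup>2 + k\<^sup>2 sin\<^sup>2 t \<le> (h + t)\<^sup>2\<close>, so the integrand
  dominates \<open>1/(h + t)\<close>. The bound shows that \<open>K(k)\<close> tends to infinity as \<open>k\<close> tends to 1.
\<close>

lemma ellipK_ge_ln:
  assumes k: "0 < k" "k < 1"
  shows "ellipK k \<ge> ln (1 + pi / (2 * compl_mod k))"
proof -
  define h where "h = compl_mod k"
  have h: "h > 0" using compl_mod_pos[OF k] by (simp add: h_def)
  have h2: "h\<^sup>2 = 1 - k\<^sup>2" using compl_mod_power2[OF k] by (simp add: h_def)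
  define D where "D = (\<lambda>x. ellipF_odd k x - (- ln (h + pi/2 - x)))"
  have "D 0 \<le> D (pi/2)"
  proof (rule DERIV_nonneg_imp_nondecreasing[where f = D])
    show "0 \<le> pi / 2" by simp
    fix x :: real assume x: "0 \<le> x" "x \<le> pi/2"
    define t where "t = pi/2 - x"
    have t: "t \<ge> 0" using x by (simp add: t_def)
    have "sin x = cos t" by (simp add: t_def sin_cos_eq)
    have "(delta k x)\<^sup>2 = 1 - k\<^sup>2 * (cos t)\<^sup>2"
      using delta_power2[OF k, of x] \<open>sin x = cos t\<close> by simp
    also have "\<dots> = h\<^sup>2 + k\<^sup>2 * (sin t)\<^sup>2"
      by (simp add: h2 cos_squared_eq algebra_simps)
    also have "\<dots> \<le> h\<^sup>2 + 1 * t\<^sup>2"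
    proof -
      have "\<bar>sin t\<bar> \<le> \<bar>t\<bar>" by (rule abs_sin_x_le_abs_x)
      then have "(sin t)\<^sup>2 \<le> t\<^sup>2" by (simp add: abs_le_square_iff)
      moreover have "k\<^sup>2 \<le> 1" using k by (simp add: power_le_one)
      ultimately show ?thesis by (intro add_left_mono mult_mono) auto
    qed
    also have "\<dots> \<le> (h + t)\<^sup>2" using h t by (simp add: power2_sum)
    finally have "delta k x \<le> h + t"
      by (rule power2_le_imp_le) (use h t in simp)
    then have "1 / (h + t) \<le> 1 / delta k x"
      by (rule frac_le[OF zero_le_one order_refl delta_pos[OF k]])
    then have "0 \<le> 1 / delta k x - 1 / (h + pi/2 - x)" by (simp add: t_def algebra_simps)
    moreover have "(D has_real_derivative 1 / delta k x - 1 / (h + pi/2 - x)) (at x)"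
    proof -
      have pos: "h + pi/2 - x > 0" using h x by simp
      have "((\<lambda>x. ln (h + pi/2 - x)) has_real_derivative (1 / (h + pi/2 - x)) * (0 - 1)) (at x)"
        by (rule DERIV_chain'[where g = ln and f = "\<lambda>x. h + pi/2 - x"], rule DERIV_diff)
           (rule DERIV_const DERIV_ident DERIV_ln_divide[OF pos])+
      from DERIV_diff[OF ellipF_odd_deriv[OF k] DERIV_minus[OF this]]
      show ?thesis unfolding D_def by simp
    qed
    ultimately show "\<exists>y. (D has_real_derivative y) (at x) \<and> 0 \<le> y"
      by blast
  qed
  then have "ln (h + pi/2) - ln h \<le> ellipK k" by (simp add: D_def ellipF_odd_half_pi)
  also have "ln (h + pi/2) - ln h = ln ((h + pi/2) / h)"     using h pi_gt_zero by (subst ln_div) (simp_all add: add_pos_pos del: pi_gt_zero)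
  also have "(h + pi/2) / h = 1 + pi / (2 * h)" using h by (simp add: field_simps)
  finally show ?thesis by (simp add: h_def)
qed

lemma modulus_ratio_compl:
  assumes k: "0 < k" "k < 1"
  shows "modulus_ratio (compl_mod k) = inverse (modulus_ratio k)"
  by (simp add: modulus_ratio_def compl_mod_compl_mod[OF k])

lemma modulus_ratio_unbounded: "\<exists>k. 0 < k \<and> k < 1 \<and> modulus_ratio k > C"
proof -
  define c where "c = ellipK (compl_mod (1/2))"
  have h: "0 < (1/2 :: real)" "(1/2 :: real) < 1" by auto
  have c: "c > 0" unfolding c_def by (intro ellipK_pos compl_mod_pos h)
  \<comment> \<open>Small enough that the logarithmic bound for the modulus \<open>k\<close> with \<open>k' = e\<close> exceeds \<open>\<bar>C\<bar> c\<close>, while \<open>K(e) < c\<close>.\<close>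
  define e where "e = min (1/2) (exp (- (\<bar>C\<bar> * c)))"
  have e: "0 < e" "e < 1" "e < compl_mod (1/2)" "ln (1 + pi / (2 * e)) > \<bar>C\<bar> * c"
  proof -
    show "0 < e" by (simp add: e_def)
    show "e < 1" unfolding e_def by (rule le_less_trans[OF min.cobounded1]) simp
    have "e \<le> 1/2" by (simp add: e_def)
    also have "1/2 < compl_mod (1/2)"
      unfolding compl_mod_def by (rule real_less_rsqrt) (simp add: power2_eq_square)
    finally show "e < compl_mod (1/2)" .
    have "exp (\<bar>C\<bar> * c) * e \<le> exp (\<bar>C\<bar> * c) * exp (- (\<bar>C\<bar> * c))"
      unfolding e_def by (intro mult_left_mono min.cobounded2) simp
    then have "exp (\<bar>C\<bar> * c) \<le> 1 / e"
      using \<open>0 < e\<close> by (simp add: exp_minus field_simps)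
    also have "1 / e < 1 + pi / (2 * e)" using \<open>0 < e\<close> pi_gt3 by (simp add: field_simps)
    finally show "ln (1 + pi / (2 * e)) > \<bar>C\<bar> * c"
      by (metis exp_gt_zero ln_exp ln_less_cancel_iff order_less_trans)
  qed
  define k where "k = compl_mod e"
  have k: "0 < k" "k < 1" "compl_mod k = e"
    using compl_mod_pos[OF e(1,2)] compl_mod_compl_mod[OF e(1,2)] by (auto simp: k_def)
  have "ellipK e < c"
    unfolding c_def by (rule ellipK_strict_mono[OF e(1,3) compl_mod_pos(2)[OF h]])
  have "\<bar>C\<bar> * ellipK e \<le> \<bar>C\<bar> * c" using \<open>ellipK e < c\<close> by (intro mult_left_mono) auto
  also have "\<dots> < ellipK k" using ellipK_ge_ln[OF k(1,2)] e(4) k(3) by simp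
  finally have "\<bar>C\<bar> < modulus_ratio k"
    using ellipK_pos[OF e(1,2)] by (simp add: modulus_ratio_def k(3) field_simps)
  then have "C < modulus_ratio k" by linarith
  then show ?thesis using k by blast
qed

text \<open>
  Passing to the complementary modulus inverts the ratio, so large values also provide values close to 0;
  the intermediate value theorem does the rest.
\<close>

lemma modulus_ratio_surj:
  assumes "C > 0"
  shows "\<exists>k. 0 < k \<and> k < 1 \<and> modulus_ratio k = C"
proof -
  obtain b where b: "0 < b" "b < 1" "modulus_ratio b > C" using modulus_ratio_unbounded by blast
  obtain a' where a': "0 < a'" "a' < 1" "modulus_ratio a' > inverse C" using modulus_ratio_unbounded by blast
  define a where "a = compl_mod a'"
  have a: "0 < a" "a < 1" using compl_mod_pos[OF a'(1,2)] by (auto simp: a_def)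
  have "inverse (modulus_ratio a') < inverse (inverse C)"
    using a'(3) assms by (intro less_imp_inverse_less) auto
  then have aC: "modulus_ratio a < C" by (simp add: a_def modulus_ratio_compl[OF a'(1,2)])
  have ab: "a < b"
  proof (rule ccontr)
    assume "\<not> a < b"
    then have "modulus_ratio b \<le> modulus_ratio a"
      using modulus_ratio_strict_mono[of b a] a b by (cases "a = b") auto
    then show False using aC b by simp
  qed
  have "\<exists>x\<ge>a. x \<le> b \<and> modulus_ratio x = C"
    using aC b ab a
    by (intro IVT' continuous_on_subset[OF modulus_ratio_continuous]) auto
  then obtain x where "a \<le> x" "x \<le> b" "modulus_ratio x = C" by blast
  then show ?thesis using a b by (intro exI[of _ x]) auto
qed

lemma modulus_eq_iff:
  "modulus_eq l m lam \<longleftrightarrow> 0 < lam \<and> lam < 1 \<and> modulus_ratio l = modulus_ratio lam / real m"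
  by (simp add: modulus_eq_def modulus_ratio_def compl_mod_def mult.commute)

lemma ex1_modulus_eq:
  assumes l: "0 < l" "l < 1" and m: "m \<ge> 1"
  shows "\<exists>!lam. modulus_eq l m lam"
proof -
  have "modulus_ratio l > 0"
    unfolding modulus_ratio_def by (intro divide_pos_pos ellipK_pos compl_mod_pos l)
  then have "real m * modulus_ratio l > 0" using m by simp
  then obtain lam where lam: "0 < lam" "lam < 1" "modulus_ratio lam = real m * modulus_ratio l"
    using modulus_ratio_surj by blast
  have iff: "modulus_eq l m x \<longleftrightarrow> 0 < x \<and> x < 1 \<and> modulus_ratio x = modulus_ratio lam" for x
    using m lam(3) by (auto simp: modulus_eq_iff field_simps)
  show ?thesis
    unfolding iff
    using lam modulus_ratio_strict_mono by (intro ex1I[of _ lam]) (auto, metis less_irrefl linorder_cases)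
qed

section \<open>Tools for meromorphic functions\<close>

lemma zorder_simple_zero:
  assumes "f analytic_on {z}" "f z = 0" "(f has_field_derivative D) (at z)" "D \<noteq> 0"
  shows "zorder f z = 1" "eventually (\<lambda>w. f w \<noteq> 0) (at z)"
proof -
  have "deriv f z \<noteq> 0"
    using assms DERIV_imp_deriv by metis
  then show "zorder f z = 1"
    using assms(1,2) by (intro zorder_zero_eqI'[where n = 1]) auto
  have "eventually (\<lambda>w. (f w - f z) / (w - z) \<noteq> 0) (at z)"
    using assms(3,4) unfolding has_field_derivative_iff by (rule tendsto_imp_eventually_ne)
  then show "eventually (\<lambda>w. f w \<noteq> 0) (at z)"
    by eventually_elim (use assms(2) in auto)
qed

lemma zorder_analytic_nonzero:
  assumes "f analytic_on {z}" "f z \<noteq> (0::complex)"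
  shows "zorder f z = 0" "eventually (\<lambda>w. f w \<noteq> 0) (at z)"
proof -
  show "zorder f z = 0" using assms by (rule zorder_eq_0I)
  show "eventually (\<lambda>w. f w \<noteq> 0) (at z)"
    by (rule tendsto_imp_eventually_ne[OF isContD[OF analytic_at_imp_isCont[OF assms(1)]] assms(2)])
qed

lemma zorder_0_imp_tendsto:
  assumes mero: "f meromorphic_on {z}" and 0: "zorder f z = 0"
  shows "\<exists>c. f \<midarrow>z\<rightarrow> c"
proof -
  have "\<not> is_pole f z"
    using 0 isolated_pole_imp_neg_zorder[of f z] mero by (auto simp: meromorphic_at_iff)
  then show ?thesis
    using mero by (auto simp: meromorphic_at_iff not_essential_def)
qed

lemma periodic_int:
  fixes g :: "complex \<Rightarrow> 'a"
  assumes "\<And>z. g (z + p) = g z"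
  shows "g (z + of_int n * p) = g z"
proof -
  have nat: "g (z + of_nat i * p) = g z" for z and i :: nat
  proof (induction i)
    case (Suc i)
    have "z + of_nat (Suc i) * p = (z + of_nat i * p) + p" by (simp add: algebra_simps)
    then show ?case using Suc assms by metis
  qed simp
  show ?thesis
  proof (cases "n \<ge> 0")
    case True
    then show ?thesis using nat[of z "nat n"] by simp
  next
    case False
    then show ?thesis using nat[of "z + of_int n * p" "nat (- n)"] by simp
  qed
qed

text \<open>
  Once the removable singularities are filled, the function is entire, and all its values are taken
  in one period rectangle.
\<close>

lemma doubly_periodic_Liouville:
  fixes f :: "complex \<Rightarrow> complex"
  assumes mero: "f meromorphic_on UNIV" and lim: "\<And>z. \<exists>c. f \<midarrow>z\<rightarrow> c"
    and ab: "a > 0" "b > 0"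
    and per: "\<And>z. f (z + of_real a) = f z" "\<And>z. f (z + \<i> * of_real b) = f z"
  obtains c where "\<And>z. f \<midarrow>z\<rightarrow> c" "\<And>z. eventually (\<lambda>w. f w = c) (at z)"
proof -
  define g where "g = remove_sings f"
  have g: "f \<midarrow>z\<rightarrow> g z" for z
  proof -
    obtain c where c: "f \<midarrow>z\<rightarrow> c" using lim by blast
    have "g z = c" unfolding g_def by (rule remove_sings_eqI[OF c])
    then show ?thesis using c by simp
  qed
  have iso: "isolated_singularity_at f z" for z
    by (rule meromorphic_on_isolated_singularity, rule meromorphic_on_subset[OF mero], simp)
  have an: "g analytic_on {z}" for z
    unfolding g_def using remove_sings_analytic_at[OF iso[of z]] lim[of z] by blast
  have holo: "g holomorphic_on UNIV"
    using an by (metis analytic_imp_holomorphic analytic_on_analytic_at UNIV_I)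
  have shift: "g (z + p) = g z" if "\<And>z. f (z + p) = f z" for z p
  proof -
    have "(\<lambda>w. f (w + p)) \<midarrow>z\<rightarrow> g (z + p)"
      using LIM_offset[OF g[of "z + p"], of p] by simp
    then have "f \<midarrow>z\<rightarrow> g (z + p)" unfolding that .
    then show ?thesis using g[of z] by (rule LIM_unique)
  qed
  have "compact (g ` cbox 0 (Complex a b))"
    by (rule compact_continuous_image)
       (auto intro: continuous_on_subset[OF holomorphic_on_imp_continuous_on[OF holo]])
  then have "bounded (g ` cbox 0 (Complex a b))" by (rule compact_imp_bounded)
  moreover have "range g \<subseteq> g ` cbox 0 (Complex a b)"
  proof
    fix y assume "y \<in> range g"
    then obtain z where y: "y = g z" by blast
    \<comment> \<open>The representative of \<open>z\<close> in the period rectangle.\<close>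
    define w where "w = Complex (a * frac (Re z / a)) (b * frac (Im z / b))"
    have z: "z = (w + of_int \<lfloor>Re z / a\<rfloor> * of_real a) + of_int \<lfloor>Im z / b\<rfloor> * (\<i> * of_real b)"
      using ab by (simp add: w_def frac_def complex_eq_iff algebra_simps)
    have p1: "g (z + of_int n * of_real a) = g z" for z n
      by (rule periodic_int) (rule shift, rule per(1))
    have p2: "g (z + of_int n * (\<i> * of_real b)) = g z" for z n
      by (rule periodic_int) (rule shift, rule per(2))
    have "g z = g w"
      by (subst z) (simp only: p1 p2)
    moreover have "w \<in> cbox 0 (Complex a b)"
      using ab by (auto simp: w_def in_cbox_complex_iff frac_ge_0 less_imp_le[OF frac_lt_1])
    ultimately show "y \<in> g ` cbox 0 (Complex a b)" using y by blast
  qed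
  ultimately have "bounded (range g)" by (rule bounded_subset)
  then obtain c where c: "\<And>z. g z = c"
    using Liouville_theorem[OF holo] by (auto simp: constant_on_def)
  show ?thesis
  proof (rule that)
    show "f \<midarrow>z\<rightarrow> c" for z using g[of z] c by simp
    show "eventually (\<lambda>w. f w = c) (at z)" for z
      using eventually_remove_sings_eq_at[OF iso[of z]] by eventually_elim (use c in \<open>simp add: g_def\<close>)
  qed
qed

lemma nicely_meromorphicD:
  assumes "f nicely_meromorphic_on UNIV"
  shows "is_pole f z \<and> f z = 0 \<or> f \<midarrow>z\<rightarrow> f z"
  using assms unfolding nicely_meromorphic_on_def by (elim conjE bspec) (rule UNIV_I)

lemma is_pole_add_inverse:
  assumes f: "f nicely_meromorphic_on UNIV" "eventually (\<lambda>w. f w \<noteq> 0) (at z)"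
    and ab: "a \<noteq> 0" "b \<noteq> 0" and 0: "f z = 0"
  shows "is_pole (\<lambda>w. a * f w + b * inverse (f w) :: complex) z"
proof -
  have "is_pole f z \<or> f \<midarrow>z\<rightarrow> 0"
    using nicely_meromorphicD[OF f(1), of z] unfolding 0 by (elim disjE conjE) (rule disjI1 disjI2, assumption)+
  then show ?thesis
  proof
    assume p: "is_pole f z"
    then have "(\<lambda>w. b * inverse (f w)) \<midarrow>z\<rightarrow> b * 0"
      unfolding is_pole_def by (intro tendsto_intros filterlim_compose[OF tendsto_inverse_0])
    moreover have "filterlim (\<lambda>w. a * f w) at_infinity (at z)"
      using p ab by (intro tendsto_mult_filterlim_at_infinity tendsto_const) (auto simp: is_pole_def)
    ultimately show ?thesis
      unfolding is_pole_def by (intro tendsto_add_filterlim_at_infinity')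
  next
    assume p: "f \<midarrow>z\<rightarrow> 0"
    then have "filterlim f (at 0) (at z)" using f(2) by (simp add: filterlim_at)
    then have "filterlim (\<lambda>w. inverse (f w)) at_infinity (at z)"
      by (rule filterlim_compose[OF filterlim_inverse_at_infinity])
    then have "filterlim (\<lambda>w. b * inverse (f w)) at_infinity (at z)"
      using ab by (intro tendsto_mult_filterlim_at_infinity[OF tendsto_const]) auto
    moreover have "(\<lambda>w. a * f w) \<midarrow>z\<rightarrow> a * 0" using p by (intro tendsto_intros)
    ultimately show ?thesis
      unfolding is_pole_def by (intro tendsto_add_filterlim_at_infinity)
  qed
qed

text \<open>
  At a zero or pole of \<open>f\<close> exactly one of the two terms is unbounded, so the sum has a pole; and
  there \<open>f z = 0\<close> and \<open>inverse 0 = 0\<close> give it the value 0 that nice meromorphy asks for.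
\<close>

lemma nicely_meromorphic_add_inverse:
  assumes f: "f nicely_meromorphic_on UNIV" "\<And>z. eventually (\<lambda>w. f w \<noteq> 0) (at z)"
    and ab: "a \<noteq> 0" "b \<noteq> 0"
  shows "(\<lambda>w. a * f w + b * inverse (f w)) nicely_meromorphic_on UNIV"
  unfolding nicely_meromorphic_on_def
proof (intro conjI ballI)
  show "(\<lambda>w. a * f w + b * inverse (f w)) meromorphic_on UNIV"
    using f(1) by (intro meromorphic_intros) (auto simp: nicely_meromorphic_on_def)
  fix z
  show "is_pole (\<lambda>w. a * f w + b * inverse (f w)) z \<and> a * f z + b * inverse (f z) = 0 \<or>
      (\<lambda>w. a * f w + b * inverse (f w)) \<midarrow>z\<rightarrow> a * f z + b * inverse (f z)"
  proof (cases "f z = 0")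
    case True
    then show ?thesis using is_pole_add_inverse[OF f ab True] by simp
  next
    case False
    then have "f \<midarrow>z\<rightarrow> f z" using nicely_meromorphicD[OF f(1), of z] by (elim disjE conjE) simp_all
    then show ?thesis using False by (auto intro!: tendsto_intros)
  qed
qed

text \<open>
  The identity theorem for the normalized functions: they agree near every point except possibly at
  the point itself, and the normalization determines the value there.
\<close>

lemma nicely_meromorphic_eqI:
  assumes f: "f nicely_meromorphic_on UNIV" and g: "g nicely_meromorphic_on UNIV"
    and eq: "frequently (\<lambda>w. f w = g w) (at z0)"
  shows "f = g"
proof
  fix z
  have mero: "f meromorphic_on UNIV" "g meromorphic_on UNIV"
    using f g by (auto simp: nicely_meromorphic_on_def)
  define h where "h = remove_sings (\<lambda>w. f w - g w)"
  have h: "h nicely_meromorphic_on UNIV"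
    unfolding h_def by (intro remove_sings_nicely_meromorphic meromorphic_intros mero)
  have ev: "eventually (\<lambda>w. h w = f w - g w) (at z)" for z
    unfolding h_def
    by (rule eventually_remove_sings_eq_at, rule meromorphic_on_isolated_singularity,
        rule meromorphic_on_diff; rule meromorphic_on_subset[OF mero(1)] meromorphic_on_subset[OF mero(2)]; simp)
  have "frequently (\<lambda>w. h w = 0) (at z0)"
    using frequently_eventually_frequently[OF eq ev] by (rule frequently_elim1) auto
  then have 0: "h w = 0" for w
    by (rule frequently_eq_meromorphic_imp_constant[OF _ h]) (simp_all add: connected_UNIV)
  have fg: "eventually (\<lambda>w. f w = g w) (at z)" using ev[of z] by eventually_elim (simp add: 0)
  have "is_pole f z \<longleftrightarrow> is_pole g z" using fg by (intro is_pole_cong) auto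
  moreover have "f \<midarrow>z\<rightarrow> c \<longleftrightarrow> g \<midarrow>z\<rightarrow> c" for c using fg by (intro filterlim_cong) auto
  moreover have "is_pole f z \<and> f z = 0 \<or> f \<midarrow>z\<rightarrow> f z" "is_pole g z \<and> g z = 0 \<or> g \<midarrow>z\<rightarrow> g z"
    using nicely_meromorphicD[OF f] nicely_meromorphicD[OF g] by this+
  moreover have "\<not> (is_pole f z \<and> f \<midarrow>z\<rightarrow> c)" for c
    by (auto simp: is_pole_def dest: not_tendsto_and_filterlim_at_infinity[OF at_neq_bot])
  ultimately show "f z = g z"
    using LIM_unique[of f "f z" z "g z"] by (cases "is_pole f z") simp_all
qed

section \<open>The function \<open>k sn + i dn\<close>\<close>

text \<open>
  With \<open>s, c, d\<close> for the real functions of \<open>x\<close> (modulus \<open>k\<close>) and \<open>s\<^sub>1, c\<^sub>1, d\<^sub>1\<close> for those of \<open>y\<close> (modulus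
  \<open>k'\<close>), the addition theorem gives
  \<open>k sn(x+iy) + i dn(x+iy) = (d\<^sub>1 + k c s\<^sub>1) (k s + i d c\<^sub>1) / (c\<^sub>1\<^sup>2 + k\<^sup>2 s\<^sup>2 s\<^sub>1\<^sup>2)\<close>, where the denominator equals
  \<open>(d\<^sub>1 + k c s\<^sub>1) (d\<^sub>1 - k c s\<^sub>1)\<close>. The second factor is the denominator that remains.
\<close>

definition sndn_den :: "real \<Rightarrow> complex \<Rightarrow> real" where
  "sndn_den k z = rdn (compl_mod k) (Im z) - k * rcn k (Re z) * rsn (compl_mod k) (Im z)"

definition sndn :: "real \<Rightarrow> complex \<Rightarrow> complex" where
  "sndn k z = (of_real (k * rsn k (Re z)) +
      \<i> * of_real (rdn k (Re z) * rcn (compl_mod k) (Im z))) / of_real (sndn_den k z)"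

text \<open>
  The partial derivative of \<open>sndn\<close> in the direction of \<open>x\<close>.
\<close>

definition sndn_deriv :: "real \<Rightarrow> complex \<Rightarrow> complex" where
  "sndn_deriv k z =
     (let s = rsn k (Re z); c = rcn k (Re z); d = rdn k (Re z);
          s1 = rsn (compl_mod k) (Im z); c1 = rcn (compl_mod k) (Im z); d1 = rdn (compl_mod k) (Im z)
      in (of_real (k * d * (c * d1 - k * s1)) -
          \<i> * of_real (k * s * c1 * (k * c * d1 + (1 - k\<^sup>2) * s1))) / of_real ((sndn_den k z)\<^sup>2))"

lemma rdn_compl_power2:
  assumes k: "0 < k" "k < 1"
  shows "(rdn (compl_mod k) y)\<^sup>2 = 1 - (1 - k\<^sup>2) * (rsn (compl_mod k) y)\<^sup>2"
  using rdn_power2[OF compl_mod_pos[OF k]] compl_mod_power2[OF k] by simp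

text \<open>
  The partial derivatives come from the real functions, and the two Cauchy-Riemann equations are
  polynomial identities modulo the relations between the squares.
\<close>

lemma sndn_has_field_derivative:
  assumes k: "0 < k" "k < 1" and nz: "sndn_den k z \<noteq> 0"
  shows "(sndn k has_field_derivative sndn_deriv k z) (at z)"
proof -
  note k' = compl_mod_pos[OF k]
  define s c d where "s = rsn k (Re z)" and "c = rcn k (Re z)" and "d = rdn k (Re z)"
  define s1 c1 d1 where "s1 = rsn (compl_mod k) (Im z)" and "c1 = rcn (compl_mod k) (Im z)"
    and "d1 = rdn (compl_mod k) (Im z)"
  define E where "E = sndn_den k z"
  have E: "E = d1 - k * c * s1"
    by (simp add: E_def sndn_den_def s1_def d1_def c_def)
  have rel: "c\<^sup>2 = 1 - s\<^sup>2" "d\<^sup>2 = 1 - k\<^sup>2 * s\<^sup>2" "c1\<^sup>2 = 1 - s1\<^sup>2" "d1\<^sup>2 = 1 - (1 - k\<^sup>2) * s1\<^sup>2"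
    by (simp_all add: s_def c_def d_def s1_def c1_def d1_def rsn_rcn rdn_power2[OF k] rdn_compl_power2[OF k])
  have dre: "((\<lambda>z. f (Re z)) has_derivative (\<lambda>h. D * Re h)) (at z)"
    if "(f has_real_derivative D) (at (Re z))" for f D
    using has_derivative_compose[OF bounded_linear_imp_has_derivative[OF bounded_linear_Re]
        that[unfolded has_field_derivative_def]] by simp
  have dim: "((\<lambda>z. f (Im z)) has_derivative (\<lambda>h. D * Im h)) (at z)"
    if "(f has_real_derivative D) (at (Im z))" for f D
    using has_derivative_compose[OF bounded_linear_imp_has_derivative[OF bounded_linear_Im]
        that[unfolded has_field_derivative_def]] by simp
  note ds = dre[OF rsn_deriv[OF k]] dre[OF rcn_deriv[OF k]] dre[OF rdn_deriv[OF k]]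
    dim[OF rsn_deriv[OF k']] dim[OF rcn_deriv[OF k']] dim[OF rdn_deriv[OF k']]
  define Ax Bx By Ex Ey where "Ax = k * (c * d)" and "Bx = - k\<^sup>2 * s * c * c1"
    and "By = - d * s1 * d1" and "Ex = k * s * d * s1"
    and "Ey = - (1 - k\<^sup>2) * s1 * c1 - k * c * c1 * d1"
  have dA: "((\<lambda>z. k * rsn k (Re z)) has_derivative (\<lambda>h. Ax * Re h)) (at z)"
    by (rule derivative_eq_intros ds refl | simp)+ (auto simp: Ax_def c_def d_def)
  have dB: "((\<lambda>z. rdn k (Re z) * rcn (compl_mod k) (Im z)) has_derivative (\<lambda>h. Bx * Re h + By * Im h)) (at z)"
    by (rule derivative_eq_intros ds refl | simp)+
       (auto simp: Bx_def By_def s_def c_def d_def s1_def d1_def c1_def algebra_simps)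
  have dE: "(sndn_den k has_derivative (\<lambda>h. Ex * Re h + Ey * Im h)) (at z)"
    unfolding sndn_den_def[abs_def]
    by (rule derivative_eq_intros ds refl | simp)+
       (auto simp: Ex_def Ey_def s_def c_def d_def s1_def d1_def c1_def algebra_simps compl_mod_power2[OF k] fun_eq_iff)
  define A B where "A = k * s" and "B = d * c1"
  have deriv: "(sndn k has_derivative (\<lambda>h. ((of_real (Ax * Re h) + \<i> * of_real (Bx * Re h + By * Im h)) * of_real E
       - (of_real A + \<i> * of_real B) * of_real (Ex * Re h + Ey * Im h)) / (of_real E * of_real E))) (at z)"
    unfolding sndn_def[abs_def]
    by (rule derivative_eq_intros dA dB dE has_derivative_divide' refl | simp add: nz)+
       (auto simp: A_def B_def E_def s_def d_def c1_def nz fun_eq_iff)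
  have cr1: "A * Ey = Bx * E - B * Ex"
    unfolding A_def B_def Bx_def Ex_def Ey_def E using rel by algebra
  have cr2: "By * E - B * Ey = Ax * E - A * Ex"
    unfolding A_def B_def Ax_def By_def Ex_def Ey_def E using rel by algebra
  have p1: "Ax * E - A * Ex = k * d * (c * d1 - k * s1)"
    unfolding A_def Ax_def Ex_def E using rel by algebra
  have p2: "Bx * E - B * Ex = - (k * s * c1 * (k * c * d1 + (1 - k\<^sup>2) * s1))"
    unfolding B_def Bx_def Ex_def E using rel by algebra
  have D: "sndn_deriv k z = (of_real (Ax * E - A * Ex) + \<i> * of_real (Bx * E - B * Ex)) / (of_real E * of_real E)"
    unfolding sndn_deriv_def Let_def p1 p2
    by (simp add: s_def c_def d_def s1_def c1_def d1_def E_def power2_eq_square)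
  have lin: "((of_real (Ax * x) + \<i> * of_real (Bx * x + By * y)) * of_real E
       - (of_real A + \<i> * of_real B) * of_real (Ex * x + Ey * y)) = (of_real (Ax * E - A * Ex) + \<i> * of_real (Bx * E - B * Ex)) * (Complex x y)"
    for x y
  proof (rule complex_eqI, goal_cases)
    case 1
    have "Ax * x * E - A * (Ex * x + Ey * y) = (Ax * E - A * Ex) * x - (Bx * E - B * Ex) * y"
      using cr1 by algebra
    then show ?case by (simp add: algebra_simps)
  next
    case 2
    have "(Bx * x + By * y) * E - B * (Ex * x + Ey * y) = (Ax * E - A * Ex) * y + (Bx * E - B * Ex) * x"
      using cr2 by algebra
    then show ?case by (simp add: algebra_simps)
  qed
  have "(\<lambda>h. ((of_real (Ax * Re h) + \<i> * of_real (Bx * Re h + By * Im h)) * of_real E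
       - (of_real A + \<i> * of_real B) * of_real (Ex * Re h + Ey * Im h)) / (of_real E * of_real E)) = (*) (sndn_deriv k z)"
    by (rule ext) (subst lin, simp add: D)
  with deriv show ?thesis
    by (simp add: has_field_derivative_def)
qed

text \<open>
  The left side is the squared modulus of the numerator of \<open>sndn\<close>, and the second factor on the right is the
  denominator after the shift \<open>y \<mapsto> y + 2K(k')\<close>. So the numerator vanishes wherever one of the two
  denominators does.
\<close>

lemma sndn_norm_identity:
  assumes k: "0 < k" "k < 1"
  shows "(k * rsn k x)\<^sup>2 + (rdn k x * rcn (compl_mod k) y)\<^sup>2 =
     (rdn (compl_mod k) y - k * rcn k x * rsn (compl_mod k) y) *
     (rdn (compl_mod k) y + k * rcn k x * rsn (compl_mod k) y)"
  using rsn_rcn[of k x] rsn_rcn[of "compl_mod k" y] rdn_power2[OF k, of x] rdn_compl_power2[OF k, of y]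
  by algebra

text \<open>
  The shift changes the signs of \<open>s\<^sub>1\<close> and \<open>c\<^sub>1\<close>, which conjugates the numerator; the product of the two
  quotients is then 1 by the preceding factorization. If a denominator vanishes, so does the numerator,
  and both sides are 0.
\<close>

lemma sndn_shift_iK':
  assumes k: "0 < k" "k < 1"
  shows "sndn k (z + 2 * \<i> * of_real (ellipK (compl_mod k))) = inverse (sndn k z)"
proof -
  note k' = compl_mod_pos[OF k]
  define A B where "A = k * rsn k (Re z)" and "B = rdn k (Re z) * rcn (compl_mod k) (Im z)"
  define E1 E2 where "E1 = sndn_den k z"
    and "E2 = rdn (compl_mod k) (Im z) + k * rcn k (Re z) * rsn (compl_mod k) (Im z)"
  have AB: "A\<^sup>2 + B\<^sup>2 = E1 * E2"
    unfolding A_def B_def E1_def E2_def sndn_den_def by (rule sndn_norm_identity[OF k])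
  have 1: "sndn k z = (of_real A + \<i> * of_real B) / of_real E1"
    by (simp add: sndn_def A_def B_def E1_def)
  have 2: "sndn k (z + 2 * \<i> * of_real (ellipK (compl_mod k))) = (of_real A - \<i> * of_real B) / of_real E2"
    by (simp add: sndn_def sndn_den_def A_def B_def E2_def rsn_add_2K[OF k'] rcn_add_2K[OF k'] rdn_add_2K[OF k'])
  show ?thesis
  proof (cases "E1 * E2 = 0")
    case True
    then have "A = 0" "B = 0" using AB by (auto simp: sum_power2_eq_zero_iff)
    then show ?thesis using 1 2 by simp
  next
    case False
    have "(of_real A + \<i> * of_real B) * (of_real A - \<i> * of_real B) = complex_of_real (A\<^sup>2 + B\<^sup>2)"
      by (simp add: algebra_simps power2_eq_square)
    then have "(of_real A + \<i> * of_real B) * (of_real A - \<i> * of_real B) = complex_of_real E1 * of_real E2"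
      using AB by simp
    then have "sndn k z * sndn k (z + 2 * \<i> * of_real (ellipK (compl_mod k))) = 1"
      unfolding 1 2 using False by (simp add: divide_simps)
    then show ?thesis by (metis inverse_unique)
  qed
qed

lemma sndn_shift_K:
  assumes k: "0 < k" "k < 1"
  shows "sndn k (z + 2 * of_real (ellipK k)) = - inverse (sndn k z)"
proof -
  have "sndn k (z + 2 * of_real (ellipK k)) = - sndn k (z + 2 * \<i> * of_real (ellipK (compl_mod k)))"
    using compl_mod_pos[OF k]
    by (simp add: sndn_def sndn_den_def rsn_add_2K rcn_add_2K rdn_add_2K k
       diff_divide_distrib add_divide_distrib)
  then show ?thesis by (simp add: sndn_shift_iK'[OF k])
qed

lemma sndn_periodic:
  assumes k: "0 < k" "k < 1"
  shows "sndn k (z + 4 * of_real (ellipK k)) = sndn k z"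
    "sndn k (z + 4 * \<i> * of_real (ellipK (compl_mod k))) = sndn k z"
  using sndn_shift_K[OF k, of "z + 2 * of_real (ellipK k)"] sndn_shift_K[OF k, of z]
    sndn_shift_iK'[OF k, of "z + 2 * \<i> * of_real (ellipK (compl_mod k))"] sndn_shift_iK'[OF k, of z]
  by (simp_all add: algebra_simps)

lemma sndn_0 [simp]:
  assumes k: "0 < k" "k < 1"
  shows "sndn k 0 = \<i>"
  using k compl_mod_pos[OF k] by (simp add: sndn_def sndn_den_def)

lemma sndn_of_real:
  assumes k: "0 < k" "k < 1"
  shows "sndn k (of_real x) = of_real (k * rsn k x) + \<i> * of_real (rdn k x)"
  using k compl_mod_pos[OF k] by (simp add: sndn_def sndn_den_def)

lemma sndn_eq_0_iff:
  assumes k: "0 < k" "k < 1"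
  shows "sndn k z = 0 \<longleftrightarrow> rsn k (Re z) = 0 \<and> rcn (compl_mod k) (Im z) = 0"
proof -
  have d: "rdn k (Re z) \<noteq> 0" using rdn_pos[OF k, of "Re z"] by simp
  have "sndn k z = 0 \<longleftrightarrow> sndn_den k z = 0 \<or> (k * rsn k (Re z) = 0 \<and> rdn k (Re z) * rcn (compl_mod k) (Im z) = 0)"
    by (auto simp: sndn_def complex_eq_iff)
  also have "\<dots> \<longleftrightarrow> rsn k (Re z) = 0 \<and> rcn (compl_mod k) (Im z) = 0"
  proof -
    have "rsn k (Re z) = 0 \<and> rcn (compl_mod k) (Im z) = 0" if "sndn_den k z = 0"
    proof -
      have "(k * rsn k (Re z))\<^sup>2 + (rdn k (Re z) * rcn (compl_mod k) (Im z))\<^sup>2 = 0"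
        using sndn_norm_identity[OF k, of "Re z" "Im z"] that by (simp add: sndn_den_def)
      then show ?thesis using d k by (auto simp: sum_power2_eq_zero_iff)
    qed
    then show ?thesis using d k by auto
  qed
  finally show ?thesis .
qed

text \<open>
  The two denominators add up to \<open>2 d\<^sub>1 > 0\<close>. So at a singular point of \<open>sndn\<close> its reciprocal is regular.
\<close>

lemma sndn_den_shift:
  assumes k: "0 < k" "k < 1" and "sndn_den k z = 0"
  shows "sndn_den k (z + 2 * \<i> * of_real (ellipK (compl_mod k))) \<noteq> 0"
proof -
  have "sndn_den k z + sndn_den k (z + 2 * \<i> * of_real (ellipK (compl_mod k))) = 2 * rdn (compl_mod k) (Im z)"
    using compl_mod_pos[OF k] by (simp add: sndn_den_def rsn_add_2K rdn_add_2K)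
  then show ?thesis using assms(3) rdn_pos[OF compl_mod_pos[OF k], of "Im z"] by auto
qed

lemma sndn_den_cont:
  assumes k: "0 < k" "k < 1"
  shows "continuous_on UNIV (sndn_den k)"
proof -
  have c: "continuous_on UNIV (rsn k)" "continuous_on UNIV (rcn k)" "continuous_on UNIV (rdn k)"
    if "0 < k" "k < 1" for k
    using rsn_deriv[OF that] rcn_deriv[OF that] rdn_deriv[OF that]
    by (auto intro!: continuous_at_imp_continuous_on DERIV_isCont)
  note [continuous_intros] = continuous_on_compose2[OF c(1)] continuous_on_compose2[OF c(2)] continuous_on_compose2[OF c(3)]
  show ?thesis
    unfolding sndn_den_def[abs_def]
    using k compl_mod_pos[OF k] by (intro continuous_intros) auto
qed

lemma sndn_analytic_at:
  assumes k: "0 < k" "k < 1" and "sndn_den k z \<noteq> 0"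
  shows "sndn k analytic_on {z}"
proof -
  have "open {z. sndn_den k z \<noteq> 0}"
    using sndn_den_cont[OF k] by (intro open_Collect_neq) (auto intro: continuous_intros)
  moreover have "sndn k holomorphic_on {z. sndn_den k z \<noteq> 0}"
    using sndn_has_field_derivative[OF k]
    by (auto simp: holomorphic_on_def field_differentiable_def intro: has_field_derivative_at_within)
  ultimately show ?thesis using assms(3) by (auto simp: analytic_at)
qed

lemma sndn_eq_inverse_shift:
  assumes k: "0 < k" "k < 1"
  shows "sndn k = (\<lambda>z. inverse (sndn k (z + 2 * \<i> * of_real (ellipK (compl_mod k)))))"
  using sndn_shift_iK'[OF k] by (intro ext) simp

text \<open>
  The lines \<open>rsn k (Re z) = 0\<close> contain all zeros, which are therefore simple, and all points with
  purely imaginary values.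
\<close>

lemma sndn_deriv_on_axis:
  assumes k: "0 < k" "k < 1" and "rsn k (Re z) = 0" "sndn_den k z \<noteq> 0"
  shows "sndn_deriv k z \<noteq> 0"
proof -
  have "(rcn k (Re z))\<^sup>2 = 1" "(rdn k (Re z))\<^sup>2 = 1"
    using assms(3) rsn_rcn[of k "Re z"] rdn_power2[OF k, of "Re z"] by auto
  then have c: "rcn k (Re z) * rcn k (Re z) = 1" and d: "rdn k (Re z) = 1"
    using rdn_pos[OF k, of "Re z"] by (auto simp: power2_eq_square power2_eq_1_iff[of "rdn k (Re z)", unfolded power2_eq_square])
  define c0 where "c0 = rcn k (Re z)"
  have "rcn k (Re z) * rdn (compl_mod k) (Im z) - k * rsn (compl_mod k) (Im z) = c0 * sndn_den k z"
    using c unfolding sndn_den_def c0_def by algebra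
  then have "sndn_deriv k z = of_real (k * (c0 * sndn_den k z)) / of_real ((sndn_den k z)\<^sup>2)"
    unfolding sndn_deriv_def Let_def assms(3) d by simp
  moreover have "c0 \<noteq> 0" using c by (auto simp: c0_def)
  ultimately show ?thesis using assms(4) k by auto
qed

lemma sndn_meromorphic:
  assumes k: "0 < k" "k < 1"
  shows "sndn k meromorphic_on A"
proof -
  have "sndn k meromorphic_on {z}" for z
  proof (cases "sndn_den k z = 0")
    case False
    then show ?thesis by (intro analytic_on_imp_meromorphic_on sndn_analytic_at[OF k])
  next
    case True
    have "(\<lambda>z. inverse (sndn k (z + 2 * \<i> * of_real (ellipK (compl_mod k))))) meromorphic_on {z}"
      by (rule meromorphic_on_inverse, rule meromorphic_on_compose[where g = "sndn k"],
          rule analytic_on_imp_meromorphic_on[OF sndn_analytic_at[OF k sndn_den_shift[OF k True]]])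
         (auto intro!: analytic_intros)
    then show ?thesis by (subst sndn_eq_inverse_shift[OF k])
  qed
  then have "\<forall>z\<in>A. sndn k meromorphic_on {z}" by simp
  then show ?thesis by (rule iffD2[OF meromorphic_on_meromorphic_at])
qed

lemma sndn_tendsto:
  assumes k: "0 < k" "k < 1" and "sndn_den k z \<noteq> 0"
  shows "sndn k \<midarrow>z\<rightarrow> sndn k z"
  by (rule isContD[OF DERIV_isCont[OF sndn_has_field_derivative[OF assms]]])

lemma sndn_pole_value:
  assumes k: "0 < k" "k < 1" and "sndn_den k z = 0"
  shows "sndn k z = 0"
  using assms by (simp add: sndn_def)

lemma sndn_simple_zero:
  assumes k: "0 < k" "k < 1" and "sndn k z = 0" "sndn_den k z \<noteq> 0"
  shows "zorder (sndn k) z = 1" "eventually (\<lambda>w. sndn k w \<noteq> 0) (at z)"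
proof -
  have s: "rsn k (Re z) = 0" using assms sndn_eq_0_iff by auto
  note zorder_simple_zero[OF sndn_analytic_at[OF k assms(4)] assms(3)
      sndn_has_field_derivative[OF k assms(4)] sndn_deriv_on_axis[OF k s assms(4)]]
  then show "zorder (sndn k) z = 1" "eventually (\<lambda>w. sndn k w \<noteq> 0) (at z)" by auto
qed

text \<open>
  The reciprocal is a translate of \<open>sndn\<close> itself, with a simple zero at \<open>z\<close>.
\<close>

lemma inverse_sndn_at_pole:
  assumes k: "0 < k" "k < 1" and "sndn_den k z = 0"
  shows "(\<lambda>w. inverse (sndn k w)) analytic_on {z}"
    and "zorder (\<lambda>w. inverse (sndn k w)) z = 1"
    and "eventually (\<lambda>w. sndn k w \<noteq> 0) (at z)"
proof -
  define \<omega> where "\<omega> = 2 * \<i> * complex_of_real (ellipK (compl_mod k))"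
  note nz = sndn_den_shift[OF k assms(3), folded \<omega>_def]
  have eq: "(\<lambda>w. inverse (sndn k w)) = (\<lambda>w. sndn k (w + \<omega>))"
    by (rule ext) (simp add: \<omega>_def sndn_shift_iK'[OF k])
  have 0: "sndn k (z + \<omega>) = 0"
    using assms by (simp add: fun_cong[OF eq, symmetric] sndn_pole_value)
  then have s: "rsn k (Re (z + \<omega>)) = 0" using sndn_eq_0_iff[OF k] by blast
  show an: "(\<lambda>w. inverse (sndn k w)) analytic_on {z}"
    unfolding eq
    by (rule analytic_on_compose_gen[where g = "sndn k" and T = "{z + \<omega>}", unfolded o_def])
       (auto intro!: analytic_intros sndn_analytic_at[OF k nz])
  have d: "((\<lambda>w. sndn k (w + \<omega>)) has_field_derivative sndn_deriv k (z + \<omega>)) (at z)"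
    using sndn_has_field_derivative[OF k nz] by (simp add: DERIV_shift)
  note * = zorder_simple_zero[OF an[unfolded eq] 0 d sndn_deriv_on_axis[OF k s nz]]
  show "zorder (\<lambda>w. inverse (sndn k w)) z = 1" using * eq by simp
  have "eventually (\<lambda>w. inverse (sndn k w) \<noteq> 0) (at z)"
    using *(2) by (simp add: fun_cong[OF eq])
  then show "eventually (\<lambda>w. sndn k w \<noteq> 0) (at z)" by eventually_elim auto
qed

lemma sndn_eventually_nonzero:
  assumes k: "0 < k" "k < 1"
  shows "eventually (\<lambda>w. sndn k w \<noteq> 0) (at z)"
proof (cases "sndn_den k z = 0")
  case True
  then show ?thesis by (rule inverse_sndn_at_pole(3)[OF k])
next
  case False
  then show ?thesis
    using sndn_simple_zero(2)[OF k _ False] zorder_analytic_nonzero(2)[OF sndn_analytic_at[OF k False]]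
    by (cases "sndn k z = 0") auto
qed

lemma sndn_zorder_pole:
  assumes k: "0 < k" "k < 1" and "sndn_den k z = 0"
  shows "zorder (sndn k) z = -1"
proof -
  have "zorder (\<lambda>w. 1 / inverse (sndn k w)) z = zorder (\<lambda>_. 1) z - zorder (\<lambda>w. inverse (sndn k w)) z"
    using inverse_sndn_at_pole[OF assms]
    by (intro zorder_divide) (auto intro!: meromorphic_intros sndn_meromorphic[OF k] eventually_frequently)
  moreover have "(\<lambda>w. 1 / inverse (sndn k w)) = sndn k"
    by (simp add: fun_eq_iff divide_inverse)
  ultimately show ?thesis using inverse_sndn_at_pole(2)[OF assms] by simp
qed

lemma sndn_is_pole:
  assumes k: "0 < k" "k < 1" and "sndn_den k z = 0"
  shows "is_pole (sndn k) z"
  by (rule zorder_neg_imp_is_pole[OF sndn_meromorphic[OF k] sndn_eventually_nonzero[OF k]])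
     (unfold sndn_zorder_pole[OF assms], simp)

lemma sndn_nicely_meromorphic:
  assumes k: "0 < k" "k < 1"
  shows "sndn k nicely_meromorphic_on A"
  unfolding nicely_meromorphic_on_def
proof (intro conjI ballI sndn_meromorphic[OF k])
  fix z
  show "is_pole (sndn k) z \<and> sndn k z = 0 \<or> sndn k \<midarrow>z\<rightarrow> sndn k z"
    using sndn_is_pole[OF k, of z] sndn_pole_value[OF k, of z] sndn_tendsto[OF k, of z] by argo
qed

section \<open>Identification with Jacobi's functions\<close>

text \<open>
  The values at \<open>u = ellipF k \<phi>\<close> with \<open>\<phi> > 0\<close> accumulate at 0, so they determine the continuation.
\<close>

lemma inversion_of_ellipF_eqI:
  assumes k: "0 < k" "k < 1"
    and f: "f nicely_meromorphic_on UNIV" "\<And>x. x \<ge> 0 \<Longrightarrow> f (of_real x) = of_real (g (am k x))"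
  shows "inversion_of_ellipF k g = f"
  unfolding inversion_of_ellipF_def
proof (rule the_equality)
  have F: "ellipF k \<phi> = ellipF_odd k \<phi>" if "\<phi> \<ge> 0" for \<phi>
    using that by (simp add: ellipF_odd_def)
  have F0: "ellipF_odd k \<phi> \<ge> 0" if "\<phi> \<ge> 0" for \<phi>
    using that ellipF_odd_expands[OF k, of 0 \<phi>] by (cases "\<phi> = 0") auto
  show f': "f nicely_meromorphic_on UNIV \<and> (\<forall>\<phi>\<ge>0. f (of_real (ellipF k \<phi>)) = of_real (g \<phi>))"
    using f F F0 am_ellipF_odd[OF k] by auto
  fix h
  assume h: "h nicely_meromorphic_on UNIV \<and> (\<forall>\<phi>\<ge>0. h (of_real (ellipF k \<phi>)) = of_real (g \<phi>))"
  have "h (of_real x) = f (of_real x)" if "x > 0" for x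
  proof -
    have "am k x \<ge> 0"
      using that ellipF_odd_am[OF k, of x] ellipF_odd_expands[OF k, of "am k x" 0] by (cases "am k x < 0") auto
    then show ?thesis
      using h f' F[of "am k x"] ellipF_odd_am[OF k, of x] by metis
  qed
  moreover have "frequently (\<lambda>w. \<exists>x>0. w = of_real x) (at (0::complex))"
    unfolding frequently_at
  proof (intro allI impI)
    fix d :: real assume "d > 0"
    then show "\<exists>x\<in>UNIV. x \<noteq> 0 \<and> dist x 0 < d \<and> (\<exists>xa>0. x = complex_of_real xa)"
      by (intro bexI[of _ "of_real (d / 2)"]) (auto intro!: exI[of _ "d/2"])
  qed
  ultimately have "frequently (\<lambda>w. h w = f w) (at 0)"
    by (auto elim!: frequently_elim1)
  then show "h = f" using h f(1) nicely_meromorphic_eqI by blast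
qed

lemma inverse_sndn_of_real:
  assumes k: "0 < k" "k < 1"
  shows "inverse (sndn k (of_real x)) = of_real (k * rsn k x) - \<i> * of_real (rdn k x)"
proof -
  have "(k * rsn k x)\<^sup>2 + (rdn k x)\<^sup>2 = 1"
    using rdn_power2[OF k, of x] by (simp add: power_mult_distrib)
  then have "complex_of_real ((k * rsn k x)\<^sup>2 + (rdn k x)\<^sup>2) = 1" by simp
  then have "sndn k (of_real x) * (of_real (k * rsn k x) - \<i> * of_real (rdn k x)) = 1"
    by (simp add: sndn_of_real[OF k] algebra_simps power2_eq_square)
  then show ?thesis by (metis inverse_unique)
qed

lemma sndn_pm_inverse_of_real:
  assumes k: "0 < k" "k < 1"
  shows "sndn k (of_real x) + inverse (sndn k (of_real x)) = 2 * of_real k * of_real (rsn k x)"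
    "sndn k (of_real x) - inverse (sndn k (of_real x)) = 2 * \<i> * of_real (rdn k x)"
  by (unfold inverse_sndn_of_real[OF k], unfold sndn_of_real[OF k], simp_all)

lemma jacobi_sn_eq:
  assumes k: "0 < k" "k < 1"
  shows "jacobi_sn k z = (sndn k z + inverse (sndn k z)) / (2 * of_real k)"
proof -
  have eq: "(1 / (2 * of_real k)) * sndn k w + (1 / (2 * of_real k)) * inverse (sndn k w) =
      (sndn k w + inverse (sndn k w)) / (2 * of_real k)" for w
    by (simp add: add_divide_distrib)
  have "jacobi_sn k = (\<lambda>w. (1 / (2 * of_real k)) * sndn k w + (1 / (2 * of_real k)) * inverse (sndn k w))"
    unfolding jacobi_sn_def
    by (rule inversion_of_ellipF_eqI[OF k nicely_meromorphic_add_inverse[OF sndn_nicely_meromorphic[OF k] sndn_eventually_nonzero[OF k]]])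
       (use k in \<open>simp_all only: eq sndn_pm_inverse_of_real[OF k], simp_all add: rsn_def\<close>)
  then show ?thesis unfolding eq by simp
qed

lemma jacobi_dn_eq:
  assumes k: "0 < k" "k < 1"
  shows "jacobi_dn k z = (sndn k z - inverse (sndn k z)) / (2 * \<i>)"
proof -
  have eq: "(1 / (2 * \<i>)) * sndn k w + (- 1 / (2 * \<i>)) * inverse (sndn k w) =
      (sndn k w - inverse (sndn k w)) / (2 * \<i>)" for w
    by (simp add: field_simps)
  have "jacobi_dn k = (\<lambda>w. (1 / (2 * \<i>)) * sndn k w + (- 1 / (2 * \<i>)) * inverse (sndn k w))"
    unfolding jacobi_dn_def
    by (rule inversion_of_ellipF_eqI[OF k nicely_meromorphic_add_inverse[OF sndn_nicely_meromorphic[OF k] sndn_eventually_nonzero[OF k]]])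
       (simp_all only: eq sndn_pm_inverse_of_real[OF k], simp_all add: rdn_def delta_def)
  then show ?thesis unfolding eq by simp
qed

lemma is_pole_jacobi_sn_iff:
  assumes k: "0 < k" "k < 1"
  shows "is_pole (jacobi_sn k) z \<longleftrightarrow> sndn k z = 0"
proof
  have eq: "jacobi_sn k = (\<lambda>w. (1 / (2 * of_real k)) * sndn k w + (1 / (2 * of_real k)) * inverse (sndn k w))"
    using jacobi_sn_eq[OF k] by (auto simp: add_divide_distrib)
  show "is_pole (jacobi_sn k) z" if "sndn k z = 0"
    unfolding eq using k that
    by (intro is_pole_add_inverse sndn_nicely_meromorphic sndn_eventually_nonzero) auto
  show "sndn k z = 0" if "is_pole (jacobi_sn k) z"
  proof (rule ccontr)
    assume "sndn k z \<noteq> 0"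
    moreover from this have "sndn k \<midarrow>z\<rightarrow> sndn k z"
      using sndn_pole_value[OF k] sndn_tendsto[OF k] by blast
    ultimately have "jacobi_sn k \<midarrow>z\<rightarrow> (1 / (2 * of_real k)) * sndn k z + (1 / (2 * of_real k)) * inverse (sndn k z)"
      unfolding eq by (intro tendsto_intros)
    then show False
      using that not_tendsto_and_filterlim_at_infinity[OF at_neq_bot] by (auto simp: is_pole_def)
  qed
qed

lemma jacobi_sn_of_real:
  assumes k: "0 < k" "k < 1"
  shows "jacobi_sn k (of_real x) = of_real (rsn k x)"
  using k by (simp add: jacobi_sn_eq[OF k] sndn_pm_inverse_of_real[OF k])

lemma jacobi_dn_of_real:
  assumes k: "0 < k" "k < 1"
  shows "jacobi_dn k (of_real x) = of_real (rdn k x)"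
  by (simp add: jacobi_dn_eq[OF k] sndn_pm_inverse_of_real[OF k])

text \<open>
  The derivative of \<open>k sn + i dn\<close> is \<open>k cn dn - i k\<^sup>2 sn cn = - i k cn (k sn + i dn)\<close>, so the continuation of
  \<open>cn\<close> is a logarithmic derivative.
\<close>

lemma jacobi_cn_of_real:
  assumes k: "0 < k" "k < 1" and x: "x \<ge> 0"
  shows "jacobi_cn k (of_real x) = of_real (rcn k x)"
proof -
  \<comment> \<open>At real arguments the denominator of \<open>sndn\<close> is 1, so this function is regular there.\<close>
  define f where "f = (\<lambda>w. \<i> * deriv (sndn k) w / (of_real k * sndn k w))"
  have mero: "f meromorphic_on UNIV"
    unfolding f_def by (intro meromorphic_intros sndn_meromorphic[OF k])
  have real: "remove_sings f (of_real x) = of_real (rcn k x)" for x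
  proof -
    have den: "sndn_den k (of_real x) = 1"
      using k compl_mod_pos[OF k] by (simp add: sndn_den_def)
    have nz: "sndn k (of_real x) \<noteq> 0"
      using compl_mod_pos[OF k] by (simp add: sndn_eq_0_iff[OF k])
    have "f analytic_on {of_real x}"
      unfolding f_def using den nz k
      by (intro analytic_intros analytic_deriv sndn_analytic_at) auto
    then have 1: "remove_sings f (of_real x) = f (of_real x)" by simp
    have "deriv (sndn k) (of_real x) = sndn_deriv k (of_real x)"
      using sndn_has_field_derivative[OF k, of "of_real x"] den by (intro DERIV_imp_deriv) simp
    also have "\<dots> = - \<i> * of_real k * of_real (rcn k x) * sndn k (of_real x)"
      using compl_mod_pos[OF k] unfolding sndn_deriv_def Let_def den sndn_of_real[OF k]
      by (simp add: algebra_simps power2_eq_square)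
    finally show ?thesis
      unfolding 1 unfolding f_def using nz k by (simp add: mult_ac)
  qed
  have "jacobi_cn k = remove_sings f"
    unfolding jacobi_cn_def
    by (rule inversion_of_ellipF_eqI[OF k remove_sings_nicely_meromorphic[OF mero]])
       (simp add: real rcn_def)
  then show ?thesis by (simp add: real)
qed

section \<open>Values on the lines \<open>Re u = 2 n K\<close>\<close>

text \<open>
  On the line \<open>Re u = 0\<close> the quotient \<open>sndn\<close> is \<open>i axis_val k (Im u)\<close>, and \<open>axis_den\<close> is its denominator.
\<close>

definition axis_den :: "real \<Rightarrow> real \<Rightarrow> real" where
  "axis_den k y = rdn (compl_mod k) y - k * rsn (compl_mod k) y"

definition axis_val :: "real \<Rightarrow> real \<Rightarrow> real" where
  "axis_val k y = rcn (compl_mod k) y / axis_den k y"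

text \<open>
  On the line \<open>Re u = 2nK\<close> one has \<open>rcn k (Re u) = (-1)\<^sup>n\<close>, and \<open>sndn k u\<close> is \<open>i axis_val k ((-1)\<^sup>n Im u)\<close>.
  So these are the points where \<open>sndn k\<close> equals \<open>i axis_val k \<tau>\<close>, or has a pole if
  \<open>axis_val k\<close> has a pole at \<open>\<tau>\<close>.
\<close>

definition on_axis :: "real \<Rightarrow> real \<Rightarrow> complex \<Rightarrow> bool" where
  "on_axis k \<tau> u \<longleftrightarrow> rsn k (Re u) = 0 \<and>
     (\<exists>r::int. rcn k (Re u) * Im u = \<tau> + 4 * ellipK (compl_mod k) * of_int r)"

text \<open>
  The factorization of \<open>d\<^sub>1\<^sup>2 - k\<^sup>2 s\<^sub>1\<^sup>2 = c\<^sub>1\<^sup>2\<close>, which gives \<open>axis_val k (- y) = 1 / axis_val k y\<close>.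
\<close>

lemma axis_den_mult:
  assumes k: "0 < k" "k < 1"
  shows "axis_den k y * axis_den k (- y) = (rcn (compl_mod k) y)\<^sup>2"
  using compl_mod_pos[OF k] rdn_compl_power2[OF k, of y] rsn_rcn[of "compl_mod k" y]
  by (simp add: axis_den_def algebra_simps power2_eq_square)

lemma axis_den_eq_0D:
  assumes k: "0 < k" "k < 1" and 0: "axis_den k y = 0"
  shows "rsn (compl_mod k) y = 1" "rcn (compl_mod k) y = 0"
proof -
  note k' = compl_mod_pos[OF k]
  show c: "rcn (compl_mod k) y = 0"
    using axis_den_mult[OF k, of y] 0 by simp
  then have "(rsn (compl_mod k) y)\<^sup>2 = 1" using rsn_rcn[of "compl_mod k" y] by simp
  moreover have "0 < k * rsn (compl_mod k) y"
    using 0 rdn_pos[OF k', of y] by (simp add: axis_den_def)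
  ultimately show "rsn (compl_mod k) y = 1"
    using k by (auto simp: power2_eq_1_iff zero_less_mult_iff)
qed

lemma axis_den_eq_0I:
  assumes k: "0 < k" "k < 1" and s: "rsn (compl_mod k) y = 1"
  shows "axis_den k y = 0"
proof -
  have "(rdn (compl_mod k) y)\<^sup>2 = k\<^sup>2" using rdn_compl_power2[OF k, of y] s by simp
  then show ?thesis
    using rdn_pos[OF compl_mod_pos[OF k], of y] k s by (simp add: axis_den_def power2_eq_iff)
qed

text \<open>
  The values \<open>(d\<^sub>1 - k s\<^sub>1)/c\<^sub>1\<close> and, by the factorization, \<open>(d\<^sub>1 + k s\<^sub>1)/c\<^sub>1\<close> are known; half their sum and
  difference give \<open>d\<^sub>1/c\<^sub>1\<close> and \<open>s\<^sub>1/c\<^sub>1\<close>. As \<open>d\<^sub>1 > 0\<close>, this determines \<open>c\<^sub>1\<close> and \<open>s\<^sub>1\<close>, hence the argument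
  modulo a period.
\<close>

lemma axis_val_inj:
  assumes k: "0 < k" "k < 1"
    and nz: "axis_den k x \<noteq> 0" "axis_den k y \<noteq> 0" and eq: "axis_val k x = axis_val k y"
  obtains r :: int where "x = y + 4 * ellipK (compl_mod k) * of_int r"
proof -
  note k' = compl_mod_pos[OF k]
  define s c d where "s = rsn (compl_mod k) x" and "c = rcn (compl_mod k) x" and "d = rdn (compl_mod k) x"
  define S C D where "S = rsn (compl_mod k) y" and "C = rcn (compl_mod k) y" and "D = rdn (compl_mod k) y"
  have pos: "d > 0" "D > 0" using rdn_pos[OF k'] by (simp_all add: d_def D_def)
  have rel: "c\<^sup>2 = 1 - s\<^sup>2" "C\<^sup>2 = 1 - S\<^sup>2"
    by (simp_all add: s_def c_def S_def C_def rsn_rcn)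
  have prod: "(d - k * s) * (d + k * s) = c\<^sup>2" "(D - k * S) * (D + k * S) = C\<^sup>2"
    using axis_den_mult[OF k, of x] axis_den_mult[OF k, of y] k'
    by (simp_all add: axis_den_def s_def c_def d_def S_def C_def D_def)
  have nz': "d - k * s \<noteq> 0" "D - k * S \<noteq> 0"
    using nz by (simp_all add: axis_den_def s_def d_def S_def D_def)
  have cross: "c * (D - k * S) = C * (d - k * s)"
    using eq nz' by (simp add: axis_val_def axis_den_def s_def c_def d_def S_def C_def D_def field_simps)
  have "s = S \<and> c = C"
  proof (cases "c = 0")
    case True
    then have C: "C = 0" using cross nz' by simp
    have "d + k * s = 0" "D + k * S = 0" using prod nz' True C by auto
    then have "s < 0" "S < 0" using pos k by (auto simp: mult_less_0_iff dest!: eq_neg_iff_add_eq_0[THEN iffD2])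
    moreover have "s\<^sup>2 = 1" "S\<^sup>2 = 1" using rel True C by auto
    ultimately show ?thesis using True C by (auto simp: power2_eq_1_iff)
  next
    case False
    then have C: "C \<noteq> 0" using cross nz' by auto
    have "c * C * (C * (d + k * s)) = c * C * (c * (D + k * S))"
      using cross prod by algebra
    then have cross2: "C * (d + k * s) = c * (D + k * S)" using False C by simp
    have a: "c * D = C * d" and b: "k * (c * S) = k * (C * s)"
      using cross cross2 by algebra+
    then have b: "c * S = C * s" using k by simp
    have "c\<^sup>2 * 1 = C\<^sup>2 * 1" using b rel by algebra
    then have "c = C \<or> c = - C" by (simp add: power2_eq_iff)
    moreover have "c \<noteq> - C"
    proof
      assume "c = - C"
      then have "C * (D + d) = 0" using a by algebra
      then show False using C pos by simp
    qed
    ultimately have "c = C" by blast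
    then show ?thesis using b C by auto
  qed
  then show ?thesis
    using rsn_rcn_inj[OF k', of x y] that by (auto simp: s_def c_def S_def C_def)
qed

lemma on_axisD:
  assumes k: "0 < k" "k < 1" and ax: "on_axis k \<tau> u"
  shows "sndn_den k u = axis_den k \<tau>" "sndn k u = \<i> * of_real (axis_val k \<tau>)"
proof -
  note k' = compl_mod_pos[OF k]
  obtain r :: int where s0: "rsn k (Re u) = 0" and r: "rcn k (Re u) * Im u = \<tau> + 4 * ellipK (compl_mod k) * of_int r"
    using ax by (auto simp: on_axis_def)
  have "(rcn k (Re u))\<^sup>2 = 1" using s0 rsn_rcn[of k "Re u"] by simp
  then have c: "rcn k (Re u) = 1 \<or> rcn k (Re u) = - 1" by (simp add: power2_eq_1_iff)
  have "(rdn k (Re u))\<^sup>2 = 1" using s0 rdn_power2[OF k, of "Re u"] by simp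
  then have d: "rdn k (Re u) = 1" using rdn_pos[OF k, of "Re u"] by (auto simp: power2_eq_1_iff)
  have *: "rcn k (Re u) * rsn (compl_mod k) (Im u) = rsn (compl_mod k) \<tau>"
    "rcn (compl_mod k) (Im u) = rcn (compl_mod k) \<tau>" "rdn (compl_mod k) (Im u) = rdn (compl_mod k) \<tau>"
  proof -
    have "rsn (compl_mod k) (rcn k (Re u) * Im u) = rsn (compl_mod k) \<tau>"
      "rcn (compl_mod k) (rcn k (Re u) * Im u) = rcn (compl_mod k) \<tau>"
      "rdn (compl_mod k) (rcn k (Re u) * Im u) = rdn (compl_mod k) \<tau>"
      unfolding r using k' by (simp_all add: rsn_add_4K rcn_add_4K rdn_add_4K)
    then show "rcn k (Re u) * rsn (compl_mod k) (Im u) = rsn (compl_mod k) \<tau>"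
    "rcn (compl_mod k) (Im u) = rcn (compl_mod k) \<tau>" "rdn (compl_mod k) (Im u) = rdn (compl_mod k) \<tau>"
      using c k' by auto
  qed
  show den: "sndn_den k u = axis_den k \<tau>"
    unfolding sndn_den_def axis_den_def *(3) by (simp add: *(1)[symmetric])
  show "sndn k u = \<i> * of_real (axis_val k \<tau>)"
    unfolding sndn_def den s0 d *(2) axis_val_def by simp
qed

lemma on_axis_self:
  assumes "rsn k (Re u) = 0"
  shows "on_axis k (rcn k (Re u) * Im u) u"
  using assms by (auto simp: on_axis_def intro: exI[of _ 0])

lemma on_axis_cong:
  assumes "on_axis k \<tau> u" "\<tau> = \<sigma> + 4 * ellipK (compl_mod k) * of_int r"
  shows "on_axis k \<sigma> u"
proof -
  obtain q :: int where "rcn k (Re u) * Im u = \<tau> + 4 * ellipK (compl_mod k) * of_int q" "rsn k (Re u) = 0"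
    using assms(1) by (auto simp: on_axis_def)
  then show ?thesis
    using assms(2) by (auto simp: on_axis_def algebra_simps intro!: exI[of _ "r + q"])
qed

text \<open>
  A purely imaginary value forces \<open>rsn k (Re u) = 0\<close>, after which \<open>axis_val\<close> is injective.
\<close>

lemma on_axisI_value:
  assumes k: "0 < k" "k < 1" and nz: "sndn_den k u \<noteq> 0" "axis_den k \<tau> \<noteq> 0"
    and eq: "sndn k u = \<i> * of_real (axis_val k \<tau>)"
  shows "on_axis k \<tau> u"
proof -
  have "Re (sndn k u) = k * rsn k (Re u) / sndn_den k u"
    by (simp add: sndn_def)
  then have s0: "rsn k (Re u) = 0" using eq nz k by simp
  note ax = on_axis_self[OF s0]
  have "axis_val k (rcn k (Re u) * Im u) = axis_val k \<tau>"
    using on_axisD(2)[OF k ax] eq by simp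
  then obtain r :: int where "rcn k (Re u) * Im u = \<tau> + 4 * ellipK (compl_mod k) * of_int r"
    using axis_val_inj[OF k _ nz(2)] on_axisD(1)[OF k ax] nz(1) by metis
  then show ?thesis using on_axis_cong[OF ax] by blast
qed

lemma on_axisI_pole:
  assumes k: "0 < k" "k < 1" and "sndn_den k u = 0" "axis_den k \<tau> = 0"
  shows "on_axis k \<tau> u"
proof -
  have s0: "rsn k (Re u) = 0" using sndn_eq_0_iff[OF k] sndn_pole_value[OF k assms(3)] by blast
  note ax = on_axis_self[OF s0]
  have "axis_den k (rcn k (Re u) * Im u) = 0" using on_axisD(1)[OF k ax] assms(3) by simp
  then obtain r :: int where "rcn k (Re u) * Im u = \<tau> + 4 * ellipK (compl_mod k) * of_int r"
    using rsn_rcn_inj[OF compl_mod_pos[OF k]] axis_den_eq_0D[OF k] assms(4) by metis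
  then show ?thesis using on_axis_cong[OF ax] by blast
qed

lemma axis_val_minus:
  assumes k: "0 < k" "k < 1"
  shows "axis_val k (- y) = inverse (axis_val k y)"
proof (cases "rcn (compl_mod k) y = 0")
  case True
  then show ?thesis using compl_mod_pos[OF k] by (simp add: axis_val_def)
next
  case False
  then have "axis_den k y * axis_den k (- y) \<noteq> 0" using axis_den_mult[OF k, of y] by simp
  then show ?thesis
    using axis_den_mult[OF k, of y] compl_mod_pos[OF k] False
    by (auto simp: axis_val_def divide_simps power2_eq_square)
qed

lemma axis_den_K:
  assumes k: "0 < k" "k < 1"
  shows "axis_den k (ellipK (compl_mod k)) = 0"
  using compl_mod_pos[OF k] by (intro axis_den_eq_0I[OF k]) (simp add: rsn_def)

lemma axis_val_K:
  assumes k: "0 < k" "k < 1"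
  shows "axis_val k (ellipK (compl_mod k)) = 0" "axis_val k (- ellipK (compl_mod k)) = 0"
  using compl_mod_pos[OF k] by (simp_all add: axis_val_def) (simp_all add: rcn_def)

text \<open>
  The first alternative describes the zeros, the second one the poles.
\<close>

lemma sndn_eq_0_iff_on_axis:
  assumes k: "0 < k" "k < 1"
  shows "sndn k v = 0 \<longleftrightarrow> on_axis k (- ellipK (compl_mod k)) v \<or> on_axis k (ellipK (compl_mod k)) v"
proof
  have nz: "axis_den k (- ellipK (compl_mod k)) \<noteq> 0"
    using axis_den_eq_0D(1)[OF k, of "- ellipK (compl_mod k)"] axis_den_eq_0D(1)[OF k axis_den_K[OF k]]
      compl_mod_pos[OF k] by auto
  show "on_axis k (- ellipK (compl_mod k)) v \<or> on_axis k (ellipK (compl_mod k)) v" if "sndn k v = 0"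
  proof (cases "sndn_den k v = 0")
    case True
    then show ?thesis using on_axisI_pole[OF k True axis_den_K[OF k]] by blast
  next
    case False
    then show ?thesis using on_axisI_value[OF k False nz] that axis_val_K[OF k] by simp
  qed
  show "sndn k v = 0" if "on_axis k (- ellipK (compl_mod k)) v \<or> on_axis k (ellipK (compl_mod k)) v"
    using that on_axisD(2)[OF k] axis_val_K[OF k] by fastforce
qed

section \<open>Moebius factors\<close>

text \<open>
  The factor \<open>(z - i b)/(1 + i b z)\<close> with \<open>b = axis_val k \<tau>\<close>. When \<open>\<tau>\<close> is a pole of \<open>axis_val k\<close>, then
  \<open>b = \<infinity>\<close> and the factor degenerates to \<open>- 1 / z\<close>.
\<close>

definition mobius :: "real \<Rightarrow> real \<Rightarrow> complex \<Rightarrow> complex" where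
  "mobius k \<tau> z = (if axis_den k \<tau> = 0 then - 1 / z
     else (z - \<i> * of_real (axis_val k \<tau>)) / (1 + \<i> * of_real (axis_val k \<tau>) * z))"

text \<open>
  If \<open>b = \<plusminus>1\<close>, numerator and denominator of the Moebius factor would be proportional.
\<close>

lemma axis_val_power2_neq_1:
  assumes k: "0 < k" "k < 1" and s: "rsn (compl_mod k) \<tau> \<noteq> 0" and nz: "axis_den k \<tau> \<noteq> 0"
  shows "(axis_val k \<tau>)\<^sup>2 \<noteq> 1"
proof
  assume "(axis_val k \<tau>)\<^sup>2 = 1"
  then have "(rcn (compl_mod k) \<tau>)\<^sup>2 = (axis_den k \<tau>)\<^sup>2"
    using nz by (simp add: axis_val_def power_divide)
  then have "axis_den k \<tau> * axis_den k (- \<tau>) = axis_den k \<tau> * axis_den k \<tau>"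
    using axis_den_mult[OF k, of \<tau>] by (simp add: power2_eq_square)
  then have "axis_den k (- \<tau>) = axis_den k \<tau>" using nz by simp
  then show False using s k compl_mod_pos[OF k] by (simp add: axis_den_def)
qed

lemma zorder_sndn:
  assumes k: "0 < k" "k < 1" and z: "axis_den k (- \<tau>) = 0"
  shows "zorder (sndn k) u = (if on_axis k \<tau> u then 1 else if on_axis k (- \<tau>) u then - 1 else 0)"
proof -
  note k' = compl_mod_pos[OF k]
  have c0: "rcn (compl_mod k) \<tau> = 0" and s: "rsn (compl_mod k) \<tau> = -1"
    using axis_den_eq_0D[OF k z] k' by auto
  have nz: "axis_den k \<tau> \<noteq> 0" using axis_den_eq_0D(1)[OF k, of \<tau>] s by auto
  have val: "axis_val k \<tau> = 0" by (simp add: axis_val_def c0)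
  show ?thesis
  proof (cases "sndn_den k u = 0")
    case True
    then have "on_axis k (- \<tau>) u" "\<not> on_axis k \<tau> u"
      using on_axisI_pole[OF k True z] on_axisD(1)[OF k, of \<tau> u] nz True by auto
    then show ?thesis using sndn_zorder_pole[OF k True] by simp
  next
    case False
    then have n: "\<not> on_axis k (- \<tau>) u" using on_axisD(1)[OF k] z by metis
    have "on_axis k \<tau> u \<longleftrightarrow> sndn k u = 0"
      using on_axisI_value[OF k False nz] on_axisD(2)[OF k] val by auto
    then show ?thesis
      using n sndn_simple_zero(1)[OF k _ False] zorder_analytic_nonzero(1)[OF sndn_analytic_at[OF k False]]
      by auto
  qed
qed

text \<open>
  The hypothesis on \<open>rsn\<close> makes the derivative of \<open>sndn\<close> nonzero at a zero, so that zeros are simple.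
\<close>

lemma zorder_linear_sndn:
  assumes k: "0 < k" "k < 1" and nz: "sndn_den k u \<noteq> 0" and a: "a \<noteq> 0"
    and ax: "a * sndn k u + b = 0 \<Longrightarrow> rsn k (Re u) = 0"
  shows "zorder (\<lambda>w. a * sndn k w + b) u = (if a * sndn k u + b = 0 then 1 else 0)"
    "eventually (\<lambda>w. a * sndn k w + b \<noteq> 0) (at u)"
proof -
  have an: "(\<lambda>w. a * sndn k w + b) analytic_on {u}"
    by (intro analytic_intros sndn_analytic_at[OF k nz])
  have d: "((\<lambda>w. a * sndn k w + b) has_field_derivative a * sndn_deriv k u) (at u)"
    by (auto intro!: derivative_eq_intros sndn_has_field_derivative[OF k nz])
  show "zorder (\<lambda>w. a * sndn k w + b) u = (if a * sndn k u + b = 0 then 1 else 0)"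
    "eventually (\<lambda>w. a * sndn k w + b \<noteq> 0) (at u)"
    using zorder_simple_zero[OF an _ d] sndn_deriv_on_axis[OF k ax nz] zorder_analytic_nonzero[OF an] a
    by (cases "a * sndn k u + b = 0"; auto)+
qed

lemma mobius_sndn_meromorphic:
  assumes k: "0 < k" "k < 1"
  shows "(\<lambda>w. mobius k \<tau> (sndn k w)) meromorphic_on A"
proof (cases "axis_den k \<tau> = 0")
  case True
  then show ?thesis unfolding mobius_def by (simp, intro meromorphic_intros sndn_meromorphic[OF k])
next
  case False
  then show ?thesis unfolding mobius_def by (simp, intro meromorphic_intros sndn_meromorphic[OF k])
qed

text \<open>
  The numerator vanishes where \<open>sndn\<close> takes the value \<open>i axis_val k \<tau>\<close>; the denominator vanishes where it takes
  the value \<open>i / axis_val k \<tau> = i axis_val k (- \<tau>)\<close>. All these zeros are simple, and at a pole of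
  \<open>sndn\<close> the factor has a finite nonzero limit unless \<open>b\<close> is 0 or infinite.
\<close>

lemma mobius_sndn_order:
  assumes k: "0 < k" "k < 1" and s: "rsn (compl_mod k) \<tau> \<noteq> 0"
  shows "zorder (\<lambda>w. mobius k \<tau> (sndn k w)) u = (if on_axis k \<tau> u then 1 else if on_axis k (- \<tau>) u then - 1 else 0)"
    "eventually (\<lambda>w. mobius k \<tau> (sndn k w) \<noteq> 0) (at u)"
proof -
  note k' = compl_mod_pos[OF k]
  define T where "T = axis_val k \<tau>"
  have "zorder (\<lambda>w. mobius k \<tau> (sndn k w)) u = (if on_axis k \<tau> u then 1 else if on_axis k (- \<tau>) u then - 1 else 0) \<and>
    eventually (\<lambda>w. mobius k \<tau> (sndn k w) \<noteq> 0) (at u)"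
  proof (cases "axis_den k \<tau> = 0")
    case True
    then have m: "mobius k \<tau> z = - 1 / z" for z by (simp add: mobius_def)
    have ex: "\<not> (on_axis k \<tau> u \<and> on_axis k (- \<tau>) u)"
    proof
      assume "on_axis k \<tau> u \<and> on_axis k (- \<tau>) u"
      then have "axis_den k (- \<tau>) = 0"
        using True on_axisD(1)[OF k, of \<tau> u] on_axisD(1)[OF k, of "- \<tau>" u] by simp
      then show False
        using axis_den_eq_0D(1)[OF k True] axis_den_eq_0D(1)[OF k, of "- \<tau>"] k' by simp
    qed
    have "zorder (\<lambda>w. - 1 / sndn k w) u = zorder (\<lambda>_. - 1) u - zorder (sndn k) u"
      by (intro zorder_divide meromorphic_intros sndn_meromorphic[OF k] eventually_frequently sndn_eventually_nonzero[OF k]) auto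
    also have "\<dots> = - zorder (sndn k) u" by simp
    also have "\<dots> = (if on_axis k \<tau> u then 1 else if on_axis k (- \<tau>) u then - 1 else 0)"
      using ex zorder_sndn[OF k, of "- \<tau>" u] True by auto
    finally show ?thesis
      unfolding m using eventually_mono[OF sndn_eventually_nonzero[OF k, of u], of "\<lambda>w. - 1 / sndn k w \<noteq> 0"] by simp
  next
    case nz: False
    then have m: "mobius k \<tau> z = (z - \<i> * of_real T) / (1 + \<i> * of_real T * z)" for z
      by (simp add: mobius_def T_def)
    have T1: "T\<^sup>2 \<noteq> 1" using axis_val_power2_neq_1[OF k s nz] by (simp add: T_def)
    show ?thesis
    proof (cases "T = 0")
      case True
      then have "rcn (compl_mod k) \<tau> = 0" using nz by (simp add: T_def axis_val_def)
      then have "axis_den k (- \<tau>) = 0" using axis_den_mult[OF k, of \<tau>] nz by simp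
      then show ?thesis
        unfolding m using True zorder_sndn[OF k] sndn_eventually_nonzero[OF k] by simp
    next
      case T0: False
      then have nz2: "axis_den k (- \<tau>) \<noteq> 0"
        using axis_den_mult[OF k, of \<tau>] by (auto simp: T_def axis_val_def)
      have T2: "axis_val k (- \<tau>) = inverse T" unfolding T_def by (rule axis_val_minus[OF k])
      show ?thesis
      proof (cases "sndn_den k u = 0")
        case True
        then have n: "\<not> on_axis k \<tau> u" "\<not> on_axis k (- \<tau>) u"
          using on_axisD(1)[OF k] nz nz2 by metis+
        \<comment> \<open>The factor written in terms of \<open>1/sndn\<close>, which is regular at a pole of \<open>sndn\<close>.\<close>
        define f where "f = (\<lambda>w. (1 - \<i> * of_real T * inverse (sndn k w)) / (inverse (sndn k w) + \<i> * of_real T))"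
        have an: "f analytic_on {u}"
          unfolding f_def using T0
          by (intro analytic_intros inverse_sndn_at_pole(1)[OF k True]) (simp add: sndn_pole_value[OF k True])
        have fu: "f u \<noteq> 0" using T0 by (simp add: f_def sndn_pole_value[OF k True])
        have ev: "eventually (\<lambda>w. mobius k \<tau> (sndn k w) = f w) (at u)"
          using sndn_eventually_nonzero[OF k, of u]
        proof eventually_elim
          case (elim w)
          have "f w = (sndn k w * (1 - \<i> * of_real T * inverse (sndn k w))) / (sndn k w * (inverse (sndn k w) + \<i> * of_real T))"
            unfolding f_def by (rule nonzero_mult_divide_mult_cancel_left[OF elim, symmetric])
          then show ?case unfolding m using elim by (simp add: algebra_simps)
        qed
        have "zorder (\<lambda>w. mobius k \<tau> (sndn k w)) u = zorder f u"
          by (intro zorder_cong ev refl)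
        moreover have "eventually (\<lambda>w. mobius k \<tau> (sndn k w) \<noteq> 0) (at u)"
          using ev zorder_analytic_nonzero(2)[OF an fu] by eventually_elim simp
        ultimately show ?thesis using zorder_analytic_nonzero(1)[OF an fu] n by simp
      next
        case False
        define z where "z = sndn k u"
        have on1: "on_axis k \<tau> u \<longleftrightarrow> 1 * z + (- (\<i> * of_real T)) = 0"
          using on_axisI_value[OF k False nz] on_axisD(2)[OF k, of \<tau> u]
          unfolding T_def z_def by (metis add.right_inverse eq_neg_iff_add_eq_0 minus_minus mult_1)
        have "1 + \<i> * of_real T * z = 0 \<longleftrightarrow> z = \<i> * of_real (inverse T)"
        proof -
          have "1 + \<i> * of_real T * z = \<i> * of_real T * (z - \<i> * of_real (inverse T))"
            using T0 by (simp add: field_simps)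
          then show ?thesis using T0 by simp
        qed
        then have on2: "on_axis k (- \<tau>) u \<longleftrightarrow> \<i> * of_real T * z + 1 = 0"
          using on_axisI_value[OF k False nz2] on_axisD(2)[OF k, of "- \<tau>" u] unfolding T2 z_def
          by (metis add.commute)
        have ex: "\<not> (on_axis k \<tau> u \<and> on_axis k (- \<tau>) u)"
        proof
          assume both: "on_axis k \<tau> u \<and> on_axis k (- \<tau>) u"
          have "1 * z + (- (\<i> * of_real T)) = 0" using both on1 by blast
          then have z: "z = \<i> * of_real T" by simp
          have "\<i> * of_real T * z + 1 = 0" using both on2 by blast
          then have "\<i> * of_real T * (\<i> * of_real T) + 1 = (0 :: complex)"
            unfolding z .
          then have "1 - complex_of_real (T\<^sup>2) = 0" by (simp add: power2_eq_square algebra_simps)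
          then have "1 - T\<^sup>2 = 0" by (metis of_real_1 of_real_diff of_real_eq_0_iff)
          then show False using T1 by simp
        qed
        note z1 = zorder_linear_sndn[OF k False, of 1 "- (\<i> * of_real T)"]
        note z2 = zorder_linear_sndn[OF k False, of "\<i> * of_real T" 1]
        have r: "1 * z + (- (\<i> * of_real T)) = 0 \<Longrightarrow> rsn k (Re u) = 0"
            "\<i> * of_real T * z + 1 = 0 \<Longrightarrow> rsn k (Re u) = 0"
          using on1 on2 by (auto simp: on_axis_def)
        note z1 = z1[folded z_def, OF _ r(1)] and z2 = z2[folded z_def, OF _ r(2)]
        have m': "mobius k \<tau> (sndn k w) = (1 * sndn k w + (- (\<i> * of_real T))) / (\<i> * of_real T * sndn k w + 1)" for w
          unfolding m by (simp add: add.commute)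
        have "zorder (\<lambda>w. (1 * sndn k w + (- (\<i> * of_real T))) / (\<i> * of_real T * sndn k w + 1)) u =
           zorder (\<lambda>w. 1 * sndn k w + (- (\<i> * of_real T))) u - zorder (\<lambda>w. \<i> * of_real T * sndn k w + 1) u"
          using z1(2) z2(2) T0
          by (intro zorder_divide meromorphic_intros sndn_meromorphic[OF k] eventually_frequently) auto
        then have "zorder (\<lambda>w. mobius k \<tau> (sndn k w)) u = (if on_axis k \<tau> u then 1 else if on_axis k (- \<tau>) u then - 1 else 0)"
          unfolding m' using z1(1) z2(1) T0 on1 on2 ex by auto
        moreover have "eventually (\<lambda>w. 1 * sndn k w + (- (\<i> * of_real T)) \<noteq> 0) (at u)"
          "eventually (\<lambda>w. \<i> * of_real T * sndn k w + 1 \<noteq> 0) (at u)"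
          using z1(2) z2(2) T0 by simp_all
        then have "eventually (\<lambda>w. mobius k \<tau> (sndn k w) \<noteq> 0) (at u)"
          unfolding m' by eventually_elim simp
        ultimately show ?thesis by blast
      qed
    qed
  qed
  then show "zorder (\<lambda>w. mobius k \<tau> (sndn k w)) u = (if on_axis k \<tau> u then 1 else if on_axis k (- \<tau>) u then - 1 else 0)"
    "eventually (\<lambda>w. mobius k \<tau> (sndn k w) \<noteq> 0) (at u)" by auto
qed

text \<open>
  On the unit circle a zero or pole would need \<open>b\<^sup>2 = 1\<close>.
\<close>

lemma mobius_nonzero_on_circle:
  assumes k: "0 < k" "k < 1" and s: "rsn (compl_mod k) \<tau> \<noteq> 0" and z: "norm z = 1"
  shows "mobius k \<tau> z \<noteq> 0"
proof (cases "axis_den k \<tau> = 0")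
  case True
  then show ?thesis using z by (auto simp: mobius_def)
next
  case False
  define T where "T = axis_val k \<tau>"
  have T: "\<bar>T\<bar> \<noteq> 1"
    using axis_val_power2_neq_1[OF k s False] by (auto simp: T_def abs_if split: if_splits)
  have "z \<noteq> \<i> * of_real T" using z T by (auto simp: norm_mult)
  moreover have "1 + \<i> * of_real T * z \<noteq> 0"
  proof
    assume "1 + \<i> * of_real T * z = 0"
    then have "\<i> * of_real T * z = - 1" by (simp add: add_eq_0_iff)
    then have "norm (\<i> * of_real T * z) = 1" by simp
    then show False using z T by (simp add: norm_mult)
  qed
  ultimately show ?thesis using False by (simp add: mobius_def T_def)
qed

lemma mobius_meromorphic: "mobius k \<tau> meromorphic_on A"
proof (cases "axis_den k \<tau> = 0")
  case True
  then have eq: "mobius k \<tau> = (\<lambda>z. - 1 / z)" by (simp add: fun_eq_iff mobius_def)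
  show ?thesis unfolding eq by (intro meromorphic_intros)
next
  case False
  then have eq: "mobius k \<tau> = (\<lambda>z. (z - \<i> * of_real (axis_val k \<tau>)) / (1 + \<i> * of_real (axis_val k \<tau>) * z))"
    by (simp add: fun_eq_iff mobius_def)
  show ?thesis unfolding eq by (intro meromorphic_intros)
qed

section \<open>The nodes of \<open>s\<close>\<close>

text \<open>
  The quotient \<open>(\<ell> sn + dn)/cn\<close> in \<open>b\<^sub>j\<close> is \<open>axis_val l\<close> at \<open>(2j-1)K'/m\<close>. The exponent \<open>-1\<close> reflects this
  argument at 0, and the sign \<open>-1\<close> together with a reflection shifts it by \<open>2K'\<close>. In units of \<open>K'/m\<close>
  the resulting argument is always \<open>-1\<close> modulo 4.
\<close>

definition node_index :: "nat \<Rightarrow> nat \<Rightarrow> int" where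
  "node_index m j = (if even m then (if odd j then 1 - 2 * int j else 2 * int j - 1)
     else (if odd j then 2 * int j - 1 + 2 * int m else 2 * int j - 1))"

lemma node_mod_4: "4 dvd node_index m j + 1"
  by (auto simp: node_index_def elim!: evenE oddE)

text \<open>
  In each combination of parities the difference, divided by 2, is a number of absolute value less than \<open>2m\<close>
  that vanishes only for \<open>i = j\<close>, yet it would have to be a multiple of \<open>2m\<close>.
\<close>

lemma node_cong_imp_eq:
  assumes ij: "i \<in> {1..m}" "j \<in> {1..m}" and d: "4 * int m dvd node_index m i - node_index m j"
  shows "i = j"
proof -
  obtain q where q: "node_index m i - node_index m j = 4 * int m * q" using d by blast
  define I J M where "I = int i" and "J = int j" and "M = int m"
  have b: "1 \<le> I" "I \<le> M" "1 \<le> J" "J \<le> M" using ij by (auto simp: I_def J_def M_def)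
  have no: False if "- 2 * M < x" "x < 2 * M" "x \<noteq> 0" "x = 2 * M * q" for x q
  proof -
    have "M > 0" using b by linarith
    have "\<bar>q\<bar> \<ge> 1" using that by auto
    then have "2 * M * 1 \<le> 2 * M * \<bar>q\<bar>" using \<open>M > 0\<close> by (intro mult_left_mono) auto
    also have "\<dots> = \<bar>x\<bar>" using that \<open>M > 0\<close> by (simp add: abs_mult)
    finally show False using that by linarith
  qed
  have "I = J"
  proof (rule ccontr)
    assume ne: "I \<noteq> J"
    consider "even i = even j" | "even m" "odd i" "even j" | "even m" "even i" "odd j"
      | "odd m" "odd i" "even j" | "odd m" "even i" "odd j" by blast
    then show False
    proof cases
      case 1
      then have "I - J = 2 * M * q \<or> I - J = 2 * M * (- q)"
        using q by (auto simp: node_index_def I_def J_def M_def split: if_splits)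
      then show False using no[of "I - J"] b ne by fastforce
    next
      case 2
      then have "I + J - 1 = 2 * M * (- q)" using q by (auto simp: node_index_def I_def J_def M_def)
      then show False using no[of "I + J - 1" "- q"] b ne by linarith
    next
      case 3
      then have "I + J - 1 = 2 * M * q" using q by (auto simp: node_index_def I_def J_def M_def)
      then show False using no[of "I + J - 1" "q"] b ne by linarith
    next
      case 4
      then have "I - J + M = 2 * M * q" using q by (auto simp: node_index_def I_def J_def M_def)
      then show False using no[of "I - J + M" "q"] b ne by linarith
    next
      case 5
      then have "I - J - M = 2 * M * q" using q by (auto simp: node_index_def I_def J_def M_def)
      then show False using no[of "I - J - M" "q"] b ne by linarith
    qed
  qed
  then show ?thesis by (simp add: I_def J_def)
qed

text \<open>
  The \<open>m\<close> indices represent distinct residues modulo \<open>4m\<close> among the \<open>m\<close> ones that are \<open>-1\<close> modulo 4.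
\<close>

lemma node_surj:
  assumes m: "m \<ge> 1"
  shows "\<exists>j\<in>{1..m}. 4 * int m dvd (4 * r - 1) - node_index m j"
proof -
  define q where "q = (\<lambda>j. (node_index m j + 1) div 4)"
  \<comment> \<open>An injective map between two sets with \<open>m\<close> elements is onto.\<close>
  define h where "h = (\<lambda>j. nat (q j mod int m))"
  have h: "int (h j) = q j mod int m" for j
    using m by (simp add: h_def)
  have node: "node_index m j = 4 * q j - 1" for j
    using node_mod_4[of m j] unfolding q_def by (simp add: dvd_mult_div_cancel)
  have "inj_on h {1..m}"
  proof (rule inj_onI)
    fix i j assume ij: "i \<in> {1..m}" "j \<in> {1..m}" "h i = h j"
    then have "q i mod int m = q j mod int m"
      using h by metis
    then have "int m dvd q i - q j"
      by (simp add: mod_eq_dvd_iff)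
    then have "4 * int m dvd 4 * (q i - q j)"
      by (rule mult_dvd_mono[OF dvd_refl])
    also have "4 * (q i - q j) = node_index m i - node_index m j"
      unfolding node[of i] node[of j] by (simp add: algebra_simps)
    finally show "i = j" using node_cong_imp_eq ij by blast
  qed
  moreover have "h ` {1..m} \<subseteq> {..<m}" using m by (auto simp: h_def nat_less_iff)
  ultimately have "h ` {1..m} = {..<m}"
    by (intro card_subset_eq) (auto simp: card_image)
  moreover have "nat (r mod int m) < m" using m by (simp add: nat_less_iff)
  ultimately obtain j where j: "j \<in> {1..m}" "h j = nat (r mod int m)" by (metis imageE lessThan_iff)
  have "r mod int m = q j mod int m" using j h[of j] m by simp
  then have "int m dvd r - q j" by (simp add: mod_eq_dvd_iff)
  then have "4 * int m dvd 4 * (r - q j)" by (rule mult_dvd_mono[OF dvd_refl])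
  also have "4 * (r - q j) = (4 * r - 1) - node_index m j" unfolding node[of j] by (simp add: algebra_simps)
  finally show ?thesis using j by blast
qed

lemma odd_node: "odd (node_index m j)"
  by (auto simp: node_index_def)

definition node_pos :: "real \<Rightarrow> nat \<Rightarrow> nat \<Rightarrow> real" where
  "node_pos l m j = of_int (node_index m j) * (ellipK (compl_mod l) / real m)"

lemma on_axis_node_iff:
  assumes m: "m \<ge> 1"
  shows "on_axis l (of_int N * (ellipK (compl_mod l) / real m)) u \<longleftrightarrow> rsn l (Re u) = 0 \<and>
     (\<exists>r::int. rcn l (Re u) * Im u = of_int (N + 4 * int m * r) * (ellipK (compl_mod l) / real m))"
  using m by (simp add: on_axis_def field_simps)

text \<open>
  Only the middle index can give the infinite value: the pole of \<open>axis_val\<close> is at \<open>K'\<close>, that is, at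
  \<open>m\<close> in units of \<open>K'/m\<close>.
\<close>

lemma axis_den_node_eq_0:
  assumes l: "0 < l" "l < 1" and j: "j \<in> {1..m}" and 0: "axis_den l (node_pos l m j) = 0"
  shows "2 * j = m + 1 \<and> even j"
proof -
  note l' = compl_mod_pos[OF l]
  have m: "m \<ge> 1" using j by auto
  obtain r :: int where "node_pos l m j = ellipK (compl_mod l) + 4 * ellipK (compl_mod l) * of_int r"
    using rsn_rcn_inj[OF l'] axis_den_eq_0D[OF l 0] axis_den_eq_0D[OF l axis_den_K[OF l]] by metis
  then have "of_int (node_index m j) * ellipK (compl_mod l) = of_int (int m * (1 + 4 * r)) * ellipK (compl_mod l)"
    using m by (simp add: node_pos_def field_simps)
  then have "real_of_int (node_index m j) = of_int (int m * (1 + 4 * r))"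
    using ellipK_pos[OF l'] by simp
  then have eq: "node_index m j = int m * (1 + 4 * r)" by linarith
  then have om: "odd m" using odd_node[of m j] by auto
  show ?thesis
  proof (cases "even j")
    case True
    have r: "2 * int j - 1 = int m * (1 + 4 * r)" using eq om True by (simp add: node_index_def)
    have "r = 0"
    proof (rule ccontr)
      assume "r \<noteq> 0"
      then have "1 + 4 * r \<le> - 3 \<or> 5 \<le> 1 + 4 * r" by linarith
      then have "int m * (1 + 4 * r) \<le> int m * (- 3) \<or> int m * 5 \<le> int m * (1 + 4 * r)"
        using mult_left_mono[of "1 + 4 * r" "- 3" "int m"] mult_left_mono[of 5 "1 + 4 * r" "int m"] by linarith
      moreover have "1 \<le> int j" "int j \<le> int m" using j by auto
      ultimately show False using r by linarith
    qed
    then have "2 * int j - 1 = int m" using r by simp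
    then show ?thesis using True by linarith
  next
    case False
    have r: "2 * int j - 1 + 2 * int m = int m * (1 + 4 * r)" using eq om False by (simp add: node_index_def)
    have "1 + 4 * r \<le> 1 \<or> 5 \<le> 1 + 4 * r" by presburger
    then have "int m * (1 + 4 * r) \<le> int m * 1 \<or> int m * 5 \<le> int m * (1 + 4 * r)"
      using mult_left_mono[of "1 + 4 * r" 1 "int m"] mult_left_mono[of 5 "1 + 4 * r" "int m"] by linarith
    moreover have "1 \<le> int j" "int j \<le> int m" using j by auto
    ultimately show ?thesis using r by linarith
  qed
qed

lemma axis_val_add_2K:
  assumes k: "0 < k" "k < 1"
  shows "axis_val k (y + 2 * ellipK (compl_mod k)) = - axis_val k (- y)"
  using compl_mod_pos[OF k] by (simp add: axis_val_def axis_den_def rsn_add_2K rcn_add_2K rdn_add_2K)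

text \<open>
  For the middle index with \<open>j\<close> odd the node is \<open>3K'\<close>, which is a zero of \<open>axis_val\<close>; with \<open>j\<close> even it is
  the pole \<open>K'\<close>.
\<close>

lemma s_factor_eq_mobius:
  assumes l: "0 < l" "l < 1" and j: "j \<in> {1..m}"
  shows "s_factor l m j z = mobius l (node_pos l m j) z"
proof -
  note l' = compl_mod_pos[OF l]
  have m: "m \<ge> 1" using j by auto
  define K' where "K' = ellipK (compl_mod l)"
  define t where "t = (2 * real j - 1) / real m * K'"
  have cm: "sqrt (1 - l\<^sup>2) = compl_mod l" by (simp add: compl_mod_def)
  have K0: "K' > 0" using ellipK_pos[OF l'] by (simp add: K'_def)
  have t0: "t \<ge> 0" using j K0 by (auto simp: t_def)
  have inv: "axis_val l t = inverse (axis_val l (- t))" using axis_val_minus[OF l, of "- t"] by simp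
  have quotient: "(of_real l * jacobi_sn (compl_mod l) (of_real t) + jacobi_dn (compl_mod l) (of_real t)) / jacobi_cn (compl_mod l) (of_real t)
     = of_real (axis_val l t)"
    unfolding jacobi_sn_of_real[OF l'] jacobi_dn_of_real[OF l'] jacobi_cn_of_real[OF l' t0] inv
    using l' by (simp add: axis_val_def axis_den_def add.commute)
  show ?thesis
  proof (cases "2 * j = m + 1")
    case True
    then have m': "real m = 2 * real j - 1" by linarith
    have "odd m" using True by presburger
    note m' = m' this
    show ?thesis
    proof (cases "even j")
      case ev: True
      have "node_pos l m j = K'"
        using m' ev m by (simp add: node_pos_def node_index_def K'_def)
      then have "axis_den l (node_pos l m j) = 0" using axis_den_K[OF l] by (simp add: K'_def)
      then show ?thesis using True ev by (simp add: s_factor_def mobius_def)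
    next
      case od: False
      have "node_pos l m j = K' + 2 * ellipK (compl_mod l)"
      proof -
        have n: "real_of_int (node_index m j) = 3 * real m"
          using m' od by (simp add: node_index_def)
        show ?thesis unfolding node_pos_def n using m by (simp add: K'_def)
      qed
      moreover have "axis_val l (- K') = 0"
        using l' by (simp add: axis_val_def K'_def, simp add: rcn_def)
      ultimately have "axis_val l (node_pos l m j) = 0"
        using axis_val_add_2K[OF l, of K'] by simp
      moreover have "axis_den l (node_pos l m j) \<noteq> 0"
        using axis_den_node_eq_0[OF l j] od by blast
      ultimately show ?thesis using True od by (simp add: s_factor_def mobius_def b_coeff_def)
    qed
  next
    case False
    then have nz: "axis_den l (node_pos l m j) \<noteq> 0" using axis_den_node_eq_0[OF l j] by blast
    have "b_coeff l m j = (- 1) ^ (m * j) * of_real (axis_val l t) powi ((- 1) ^ j)"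
      using False quotient by (simp add: b_coeff_def Let_def cm t_def K'_def)
    also have "\<dots> = of_real (axis_val l (node_pos l m j))"
    proof -
      consider "even m" "even j" | "even m" "odd j" | "odd m" "even j" | "odd m" "odd j" by blast
      then show ?thesis
      proof cases
        case 1
        then have "node_pos l m j = t" by (simp add: node_pos_def node_index_def t_def K'_def)
        then show ?thesis using 1 by simp
      next
        case 2
        then have "node_pos l m j = - t" using m by (simp add: node_pos_def node_index_def t_def K'_def field_simps)
        then show ?thesis using 2 axis_val_minus[OF l, of t] by (simp add: power_int_minus)
      next
        case 3
        then have "node_pos l m j = t" by (simp add: node_pos_def node_index_def t_def K'_def)
        then show ?thesis using 3 by simp
      next
        case 4
        then have "node_pos l m j = t + 2 * ellipK (compl_mod l)"
          using m by (simp add: node_pos_def node_index_def t_def K'_def field_simps)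
        then show ?thesis
          using 4 axis_val_minus[OF l, of t] axis_val_add_2K[OF l, of t] by (simp add: power_int_minus)
      qed
    qed
    finally show ?thesis using False nz by (simp add: s_factor_def mobius_def)
  qed
qed

lemma s_fun_eq_mobius:
  assumes l: "0 < l" "l < 1"
  shows "s_fun l m z = \<i> powi (1 - int m) * (\<Prod>j=1..m. mobius l (node_pos l m j) z)"
  unfolding s_fun_def using s_factor_eq_mobius[OF l] by simp

lemma rsn_node_pos:
  assumes l: "0 < l" "l < 1" and m: "m \<ge> 1"
  shows "rsn (compl_mod l) (node_pos l m j) \<noteq> 0"
proof
  note l' = compl_mod_pos[OF l]
  assume "rsn (compl_mod l) (node_pos l m j) = 0"
  then obtain n :: int where "node_pos l m j = 2 * ellipK (compl_mod l) * of_int n"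
    using rsn_eq_0_imp[OF l'] by blast
  then have "of_int (node_index m j) * ellipK (compl_mod l) = of_int (2 * int m * n) * ellipK (compl_mod l)"
    using m by (simp add: node_pos_def field_simps)
  then have "real_of_int (node_index m j) = of_int (2 * int m * n)" using ellipK_pos[OF l'] by simp
  then have "node_index m j = 2 * int m * n" by linarith
  then show False using odd_node[of m j] by simp
qed

section \<open>The transformation of degree \<open>m\<close>\<close>

text \<open>
  The zeros of \<open>sn\<close> on the real line are the points \<open>2nK\<close>, where \<open>cn\<close> is \<open>(-1)\<^sup>n\<close>; neither statement
  depends on the modulus once the argument is measured in units of \<open>K\<close>.
\<close>

lemma rsn_rcn_rescale:
  assumes k: "0 < k" "k < 1" and k': "0 < k'" "k' < 1"
  shows "rsn k' (x * ellipK k' / ellipK k) = 0 \<longleftrightarrow> rsn k x = 0"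
    "rsn k x = 0 \<Longrightarrow> rcn k' (x * ellipK k' / ellipK k) = rcn k x"
proof -
  have K: "ellipK k > 0" "ellipK k' > 0" using ellipK_pos k k' by auto
  have am: "am k (2 * ellipK k * of_int n) = pi * of_int n" if "0 < k" "k < 1" for k n
    using am_add_int[OF that, of 0 n] that by simp
  have *: "rsn k' (x * ellipK k' / ellipK k) = 0 \<and> rcn k' (x * ellipK k' / ellipK k) = rcn k x"
    if kk: "0 < k" "k < 1" "0 < k'" "k' < 1" "rsn k x = 0" for x k k'
  proof -
    have K: "ellipK k > 0" using ellipK_pos kk by auto
    obtain n :: int where n: "x = 2 * ellipK k * of_int n" using rsn_eq_0_imp[OF kk(1,2,5)] by blast
    have "x * ellipK k' / ellipK k = 2 * ellipK k' * of_int n" using n K by simp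
    then show ?thesis using n am[OF kk(1,2)] am[OF kk(3,4)] by (simp add: rsn_def rcn_def sin_zero_iff_int2 mult.commute)
  qed
  show "rsn k x = 0 \<Longrightarrow> rcn k' (x * ellipK k' / ellipK k) = rcn k x"
    using *[OF k k'] by blast
  show "rsn k' (x * ellipK k' / ellipK k) = 0 \<longleftrightarrow> rsn k x = 0"
    using *[OF k k', of x] *[OF k' k, of "x * ellipK k' / ellipK k"] K by auto
qed

lemma on_axis_uminus_iff: "on_axis k (- \<tau>) u \<longleftrightarrow> on_axis k \<tau> (cnj u)"
proof -
  have *: "on_axis k (- \<tau>) u" if ax: "on_axis k \<tau> (cnj u)" for \<tau> u
  proof -
    obtain r :: int where "rsn k (Re u) = 0" "- (rcn k (Re u) * Im u) = \<tau> + 4 * ellipK (compl_mod k) * of_int r"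
      using ax unfolding on_axis_def by auto
    then show ?thesis by (auto simp: on_axis_def intro!: exI[of _ "- r"])
  qed
  show ?thesis using *[of \<tau> u] *[of "- \<tau>" "cnj u"] by auto
qed

locale transformation =
  fixes l lam M :: real and m :: nat
  assumes l: "0 < l" "l < 1" and m: "m \<ge> 1" and modulus: "modulus_eq l m lam"
    and M: "M = ellipK l / ellipK lam"
begin

lemma lam: "0 < lam" "lam < 1"
  using modulus by (auto simp: modulus_eq_def)

lemma M_pos: "M > 0"
  unfolding M by (intro divide_pos_pos ellipK_pos l lam)

text \<open>
  The modulus equation, solved for the image of \<open>K(\<ell>')\<close> under \<open>u \<mapsto> u/M\<close>.
\<close>

lemma compl_period: "ellipK (compl_mod l) / M = real m * ellipK (compl_mod lam)"
proof -
  have pos: "ellipK l > 0" "ellipK lam > 0" "ellipK (compl_mod l) > 0" "ellipK (compl_mod lam) > 0"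
    using ellipK_pos l lam compl_mod_pos by auto
  have "ellipK l / ellipK (compl_mod l) = ellipK lam / (real m * ellipK (compl_mod lam))"
    using modulus by (simp add: modulus_eq_def compl_mod_def)
  then show ?thesis using pos m by (simp add: M field_simps)
qed

lemma on_axis_lam_iff:
  "on_axis lam (e * ellipK (compl_mod lam)) (u / of_real M) \<longleftrightarrow> rsn l (Re u) = 0 \<and>
     (\<exists>r::int. rcn l (Re u) * Im u = (e + 4 * of_int r) * (ellipK (compl_mod l) / real m))"
proof -
  have re: "Re (u / of_real M) = Re u * ellipK lam / ellipK l"
    using M_pos by (simp add: M)
  note rs = rsn_rcn_rescale[OF l lam, of "Re u"]
  have K': "ellipK (compl_mod lam) = ellipK (compl_mod l) / real m / M"
    using compl_period m M_pos by (simp add: divide_simps mult_ac)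
  have eq: "rcn l (Re u) * (Im u / M) = e * ellipK (compl_mod lam) + 4 * ellipK (compl_mod lam) * of_int r \<longleftrightarrow>
    rcn l (Re u) * Im u = (e + 4 * of_int r) * (ellipK (compl_mod l) / real m)" for r :: int
    unfolding K' using M_pos m by (simp add: field_simps)
  show ?thesis
  proof (cases "rsn l (Re u) = 0")
    case True
    then show ?thesis
      unfolding on_axis_def re using rs eq by simp
  next
    case False
    then show ?thesis unfolding on_axis_def re using rs by simp
  qed
qed

text \<open>
  Division by \<open>M\<close> turns \<open>K(\<ell>')/m\<close> into \<open>K(\<lambda>')\<close>. So the zeros of \<open>sndn lam (u/M)\<close> are, in units of \<open>K(\<ell>')/m\<close>,
  at the integers that are \<open>-1\<close> modulo 4, and each of these is congruent to exactly one \<open>node_index\<close> modulo \<open>4m\<close>.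
\<close>

lemma on_axis_nodes:
  "on_axis lam (- ellipK (compl_mod lam)) (u / of_real M) \<longleftrightarrow> (\<exists>j\<in>{1..m}. on_axis l (node_pos l m j) u)"
  "on_axis lam (ellipK (compl_mod lam)) (u / of_real M) \<longleftrightarrow> (\<exists>j\<in>{1..m}. on_axis l (- node_pos l m j) u)"
proof -
  define h where "h = ellipK (compl_mod l) / real m"
  note node = on_axis_node_iff[OF m, of l _ u, folded h_def]
  have "(\<exists>r::int. x = (- 1 + 4 * of_int r) * h) \<longleftrightarrow> (\<exists>j\<in>{1..m}. \<exists>r::int. x = of_int (node_index m j + 4 * int m * r) * h)" for x
  proof safe
    fix r :: int
    obtain j q where j: "j \<in> {1..m}" "(4 * r - 1) - node_index m j = 4 * int m * q"
      using node_surj[OF m, of r] by (auto elim!: dvdE)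
    then have e: "node_index m j + 4 * int m * q = - 1 + 4 * r" by simp
    have "(- 1 + 4 * of_int r) * h = of_int (node_index m j + 4 * int m * q) * h"
      unfolding e by simp
    then show "\<exists>j\<in>{1..m}. \<exists>ra::int. (- 1 + 4 * of_int r) * h = of_int (node_index m j + 4 * int m * ra) * h"
      using j by blast
  next
    fix j and r :: int
    obtain q where "node_index m j + 1 = 4 * q" using node_mod_4 by (auto elim!: dvdE)
    then have e: "node_index m j + 4 * int m * r = - 1 + 4 * (q + int m * r)" by (simp add: algebra_simps)
    have "of_int (node_index m j + 4 * int m * r) * h = (- 1 + 4 * of_int (q + int m * r)) * h"
      unfolding e by simp
    then show "\<exists>ra::int. of_int (node_index m j + 4 * int m * r) * h = (- 1 + 4 * of_int ra) * h" by blast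
  qed
  note key = this
  show "on_axis lam (- ellipK (compl_mod lam)) (u / of_real M) \<longleftrightarrow> (\<exists>j\<in>{1..m}. on_axis l (node_pos l m j) u)"
    using on_axis_lam_iff[of "- 1" u] key[of "rcn l (Re u) * Im u"]
    unfolding node_pos_def h_def[symmetric] node by auto
  have neg: "- (of_int N * h) = of_int (- N) * h" for N by simp
  have key2: "(\<exists>r::int. x = (1 + 4 * of_int r) * h) \<longleftrightarrow> (\<exists>j\<in>{1..m}. \<exists>r::int. x = of_int (- node_index m j + 4 * int m * r) * h)" for x
  proof -
    have "(\<exists>r::int. x = (1 + 4 * of_int r) * h) \<longleftrightarrow> (\<exists>r::int. - x = (- 1 + 4 * of_int r) * h)"
    proof safe
      fix r :: int
      show "\<exists>ra::int. - ((1 + 4 * of_int r) * h) = (- 1 + 4 * of_int ra) * h"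
        by (intro exI[of _ "- r"]) (simp add: algebra_simps)
    next
      fix r :: int assume "- x = (- 1 + 4 * of_int r) * h"
      then show "\<exists>r::int. x = (1 + 4 * of_int r) * h"
        by (intro exI[of _ "- r"]) (simp add: algebra_simps)
    qed
    also have "\<dots> \<longleftrightarrow> (\<exists>j\<in>{1..m}. \<exists>r::int. - x = of_int (node_index m j + 4 * int m * r) * h)" by (rule key)
    also have "\<dots> \<longleftrightarrow> (\<exists>j\<in>{1..m}. \<exists>r::int. x = of_int (- node_index m j + 4 * int m * r) * h)"
    proof (rule bex_cong[OF refl], safe)
      fix j and r :: int assume "- x = of_int (node_index m j + 4 * int m * r) * h"
      then show "\<exists>r::int. x = of_int (- node_index m j + 4 * int m * r) * h"
        by (intro exI[of _ "- r"]) (simp add: algebra_simps)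
    next
      fix j and r :: int
      show "\<exists>ra::int. - (of_int (- node_index m j + 4 * int m * r) * h) = of_int (node_index m j + 4 * int m * ra) * h"
        by (intro exI[of _ "- r"]) (simp add: algebra_simps)
    qed
    finally show ?thesis .
  qed
  show "on_axis lam (ellipK (compl_mod lam)) (u / of_real M) \<longleftrightarrow> (\<exists>j\<in>{1..m}. on_axis l (- node_pos l m j) u)"
    using on_axis_lam_iff[of 1 u] key2[of "rcn l (Re u) * Im u"]
    unfolding node_pos_def h_def[symmetric] neg node by auto
qed

lemma node_unique:
  assumes "i \<in> {1..m}" "j \<in> {1..m}" "on_axis l (node_pos l m i) u" "on_axis l (node_pos l m j) u"
  shows "i = j"
proof -
  have h: "ellipK (compl_mod l) / real m > 0" using ellipK_pos compl_mod_pos l m by simp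
  obtain r q :: int where "of_int (node_index m i + 4 * int m * r) * (ellipK (compl_mod l) / real m) =
      of_int (node_index m j + 4 * int m * q) * (ellipK (compl_mod l) / real m)"
    using assms(3,4) unfolding node_pos_def on_axis_node_iff[OF m] by metis
  then have "real_of_int (node_index m i + 4 * int m * r) = of_int (node_index m j + 4 * int m * q)"
    using h by (metis less_irrefl mult_right_cancel)
  then have "node_index m i + 4 * int m * r = node_index m j + 4 * int m * q" by linarith
  then have "node_index m i - node_index m j = 4 * int m * (q - r)" by (simp add: algebra_simps)
  then show ?thesis using node_cong_imp_eq[OF assms(1,2)] by (metis dvd_triv_left)
qed

text \<open>
  All indices are \<open>-1\<close> modulo 4, so \<open>N + N'\<close> is 2 modulo 4 and \<open>N\<close>, \<open>-N'\<close> cannot be congruent modulo \<open>4m\<close>.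
  This excludes cancellations between the factors of \<open>s\<close>.
\<close>

lemma node_not_both:
  assumes "on_axis l (node_pos l m i) u" "on_axis l (- node_pos l m j) u"
  shows False
proof -
  have h: "ellipK (compl_mod l) / real m > 0" using ellipK_pos compl_mod_pos l m by simp
  have neg: "- node_pos l m j = of_int (- node_index m j) * (ellipK (compl_mod l) / real m)"
    by (simp add: node_pos_def)
  obtain r q :: int where "of_int (node_index m i + 4 * int m * r) * (ellipK (compl_mod l) / real m) =
      of_int (- node_index m j + 4 * int m * q) * (ellipK (compl_mod l) / real m)"
    using assms unfolding neg unfolding node_pos_def on_axis_node_iff[OF m] by metis
  then have "real_of_int (node_index m i + 4 * int m * r) = of_int (- node_index m j + 4 * int m * q)"
    using h by (metis less_irrefl mult_right_cancel)
  then have "node_index m i + 4 * int m * r = - node_index m j + 4 * int m * q" by linarith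
  moreover obtain a b where "node_index m i + 1 = 4 * a" "node_index m j + 1 = 4 * b"
    using node_mod_4 by (meson dvdE)
  ultimately have "4 * (a + b + int m * r - int m * q) = 2" by (simp add: algebra_simps)
  then show False by presburger
qed

definition s_pullback :: "complex \<Rightarrow> complex" where
  "s_pullback u = s_fun l m (sndn l u)"

lemma s_pullback_eq: "s_pullback = (\<lambda>u. \<i> powi (1 - int m) * (\<Prod>j=1..m. mobius l (node_pos l m j) (sndn l u)))"
  by (simp add: s_pullback_def[abs_def] s_fun_eq_mobius[OF l])

definition sndn_rescaled :: "complex \<Rightarrow> complex" where
  "sndn_rescaled u = sndn lam (u / of_real M)"

lemma s_pullback_meromorphic: "s_pullback meromorphic_on A"
  unfolding s_pullback_eq by (intro meromorphic_intros mobius_sndn_meromorphic l)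

lemma sndn_rescaled_scale: "sndn_rescaled = (\<lambda>u. sndn lam ((1 / of_real M) * u))"
  by (simp add: sndn_rescaled_def fun_eq_iff)

lemma sndn_rescaled_meromorphic: "sndn_rescaled meromorphic_on A"
  unfolding sndn_rescaled_scale
  by (rule meromorphic_on_compose[OF sndn_meromorphic[OF lam, of UNIV]]) (use M_pos in \<open>auto intro!: analytic_intros\<close>)

lemma prod_nonzero: "eventually (\<lambda>w. (\<Prod>j=1..m. mobius l (node_pos l m j) (sndn l w)) \<noteq> 0) (at u)"
proof -
  have "eventually (\<lambda>w. \<forall>j\<in>{1..m}. mobius l (node_pos l m j) (sndn l w) \<noteq> 0) (at u)"
    using mobius_sndn_order(2)[OF l rsn_node_pos[OF l m]] by (intro eventually_ball_finite) auto
  then show ?thesis by eventually_elim simp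
qed

lemma s_pullback_nonzero: "eventually (\<lambda>w. s_pullback w \<noteq> 0) (at u)"
  using prod_nonzero[of u] unfolding s_pullback_eq by eventually_elim simp

lemma sndn_rescaled_nonzero: "eventually (\<lambda>w. sndn_rescaled w \<noteq> 0) (at u)"
proof -
  have "filterlim (\<lambda>w. w / of_real M) (at (u / of_real M)) (at u)"
    using M_pos by (intro filterlim_atI tendsto_intros) (auto simp: eventually_at_filter)
  then show ?thesis
    unfolding sndn_rescaled_def by (rule eventually_compose_filterlim[OF sndn_eventually_nonzero[OF lam]])
qed

text \<open>
  At each point at most one of the \<open>m\<close> factors has a zero or a pole.
\<close>

lemma zorder_s_pullback:
  "zorder s_pullback u = (if on_axis lam (- ellipK (compl_mod lam)) (u / of_real M) then 1
     else if on_axis lam (ellipK (compl_mod lam)) (u / of_real M) then - 1 else 0)"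
proof -
  let ?f = "\<lambda>j. (if on_axis l (node_pos l m j) u then 1 else if on_axis l (- node_pos l m j) u then - 1 else (0::int))"
  have "zorder s_pullback u = zorder (\<lambda>w. \<Prod>j=1..m. mobius l (node_pos l m j) (sndn l w)) u"
    unfolding s_pullback_eq by (rule zorder_cmult) simp
  also have "\<dots> = (\<Sum>j=1..m. zorder (\<lambda>w. mobius l (node_pos l m j) (sndn l w)) u)"
    by (intro zorder_prod mobius_sndn_meromorphic l prod_nonzero)
  also have "\<dots> = (\<Sum>j=1..m. ?f j)"
    by (intro sum.cong refl mobius_sndn_order(1) l rsn_node_pos m)
  also have "\<dots> = (if \<exists>j\<in>{1..m}. on_axis l (node_pos l m j) u then 1
     else if \<exists>j\<in>{1..m}. on_axis l (- node_pos l m j) u then - 1 else 0)"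
  proof -
    consider j where "j \<in> {1..m}" "on_axis l (node_pos l m j) u"
      | j where "j \<in> {1..m}" "on_axis l (- node_pos l m j) u" "\<not> (\<exists>j\<in>{1..m}. on_axis l (node_pos l m j) u)"
      | "\<not> (\<exists>j\<in>{1..m}. on_axis l (node_pos l m j) u)" "\<not> (\<exists>j\<in>{1..m}. on_axis l (- node_pos l m j) u)"
      by blast
    then show ?thesis
    proof cases
      case (1 j)
      have "(\<Sum>i=1..m. ?f i) = (\<Sum>i=1..m. if i = j then 1 else 0)"
      proof (intro sum.cong refl)
        fix i assume i: "i \<in> {1..m}"
        show "?f i = (if i = j then 1 else 0)"
          using node_unique[OF i 1(1) _ 1(2)] node_not_both[OF 1(2), of i] 1(2) by (cases "i = j") auto
      qed
      then show ?thesis using 1 by auto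
    next
      case (2 j)
      \<comment> \<open>Complex conjugation of \<open>u\<close> exchanges the points for \<open>\<tau>\<close> and \<open>-\<tau>\<close>, which reduces this case to the first one.\<close>
      have minus: "on_axis l (- node_pos l m i) u \<longleftrightarrow> i = j" if "i \<in> {1..m}" for i
      proof
        show "i = j" if "on_axis l (- node_pos l m i) u"
          using node_unique[OF \<open>i \<in> {1..m}\<close> 2(1)] that 2(2) unfolding on_axis_uminus_iff by blast
      qed (use 2 in auto)
      have "(\<Sum>i=1..m. ?f i) = (\<Sum>i=1..m. if i = j then - 1 else 0)"
      proof (intro sum.cong refl)
        fix i assume i: "i \<in> {1..m}"
        show "?f i = (if i = j then - 1 else 0)"
          using minus[OF i] 2(3) i by auto
      qed
      then show ?thesis using 2 by auto
    next
      case 3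
      then show ?thesis by auto
    qed
  qed
  finally show ?thesis unfolding on_axis_nodes .
qed

lemma zorder_sndn_rescaled:
  "zorder sndn_rescaled u = (if on_axis lam (- ellipK (compl_mod lam)) (u / of_real M) then 1
     else if on_axis lam (ellipK (compl_mod lam)) (u / of_real M) then - 1 else 0)"
proof -
  have "zorder sndn_rescaled u = zorder (sndn lam) ((1 / of_real M) * u)"
    unfolding sndn_rescaled_scale using M_pos by (intro zorder_scale sndn_meromorphic[OF lam]) auto
  also have "\<dots> = zorder (sndn lam) (u / of_real M)" by simp
  finally show ?thesis
    using zorder_sndn[OF lam, of "- ellipK (compl_mod lam)"] axis_den_K[OF lam] by simp
qed

lemma s_pullback_eq_rhs_eventually: "eventually (\<lambda>w. s_pullback w = sndn_rescaled w) (at u)"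
proof -
  define h where "h = (\<lambda>w. s_pullback w / sndn_rescaled w)"
  have mero: "h meromorphic_on A" for A
    unfolding h_def by (intro meromorphic_intros s_pullback_meromorphic sndn_rescaled_meromorphic)
  have "zorder h z = 0" for z
  proof -
    have "zorder h z = zorder s_pullback z - zorder sndn_rescaled z"
      unfolding h_def
      by (intro zorder_divide s_pullback_meromorphic sndn_rescaled_meromorphic eventually_frequently s_pullback_nonzero sndn_rescaled_nonzero) auto
    then show ?thesis by (simp add: zorder_s_pullback zorder_sndn_rescaled)
  qed
  then have lim: "\<exists>c. h \<midarrow>z\<rightarrow> c" for z
    using zorder_0_imp_tendsto[OF mero] by blast
  have pos: "ellipK l > 0" "ellipK (compl_mod l) > 0" using ellipK_pos compl_mod_pos l by auto
  have p1: "h (z + of_real (4 * ellipK l)) = h z" for z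
  proof -
    have "(z + of_real (4 * ellipK l)) / of_real M = z / of_real M + 4 * of_real (ellipK lam)"
      using pos(1) M_pos ellipK_pos[OF lam] by (simp add: M field_simps)
    then show ?thesis
      by (simp add: h_def s_pullback_def sndn_rescaled_def sndn_periodic[OF l] sndn_periodic[OF lam])
  qed
  have p2: "h (z + \<i> * of_real (4 * ellipK (compl_mod l))) = h z" for z
  proof -
    have "(z + \<i> * of_real (4 * ellipK (compl_mod l))) / of_real M =
       z / of_real M + 4 * \<i> * of_real (ellipK (compl_mod l) / M)"
      by (simp add: add_divide_distrib)
    also have "\<dots> = z / of_real M + of_int (int m) * (4 * \<i> * of_real (ellipK (compl_mod lam)))"
      unfolding compl_period by simp
    finally have "sndn_rescaled (z + \<i> * of_real (4 * ellipK (compl_mod l))) = sndn_rescaled z"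
      unfolding sndn_rescaled_def using periodic_int[of "sndn lam", OF sndn_periodic(2)[OF lam]] by metis
    moreover have "s_pullback (z + \<i> * of_real (4 * ellipK (compl_mod l))) = s_pullback z"
      using sndn_periodic(2)[OF l, of z] by (simp add: s_pullback_def mult_ac)
    ultimately show ?thesis by (simp add: h_def)
  qed
  obtain c where c: "\<And>z. h \<midarrow>z\<rightarrow> c" "\<And>z. eventually (\<lambda>w. h w = c) (at z)"
    using doubly_periodic_Liouville[OF mero lim, of "4 * ellipK l" "4 * ellipK (compl_mod l)"] p1 p2 pos by auto
  have "c = 1"
  proof -
    have den0: "sndn_den k 0 \<noteq> 0" if "0 < k" "k < 1" for k
      using that compl_mod_pos[OF that] by (simp add: sndn_den_def)
    have s: "sndn k \<midarrow>0\<rightarrow> \<i>" if "0 < k" "k < 1" for k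
      using sndn_tendsto[OF that den0[OF that]] that by simp
    have r: "sndn_rescaled \<midarrow>0\<rightarrow> \<i>"
    proof -
      have "(\<lambda>w. w / complex_of_real M) \<midarrow>0\<rightarrow> 0 / of_real M"
        by (intro tendsto_intros) (use M_pos in auto)
      then have "filterlim (\<lambda>w. w / complex_of_real M) (at 0) (at 0)"
        using M_pos by (intro filterlim_atI) (auto simp: eventually_at_filter)
      then show ?thesis unfolding sndn_rescaled_def by (rule filterlim_compose[OF s[OF lam]])
    qed
    \<comment> \<open>Every factor fixes the point \<open>i\<close>, the value of \<open>sndn\<close> at 0.\<close>
    have mb: "(\<lambda>w. mobius l (node_pos l m j) (sndn l w)) \<midarrow>0\<rightarrow> \<i>" for j
    proof (cases "axis_den l (node_pos l m j) = 0")
      case True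
      have "(\<lambda>w. - 1 / sndn l w) \<midarrow>0\<rightarrow> - 1 / \<i>" by (intro tendsto_intros s l) auto
      then show ?thesis using True by (simp add: mobius_def)
    next
      case False
      define T where "T = axis_val l (node_pos l m j)"
      have "T\<^sup>2 \<noteq> 1" using axis_val_power2_neq_1[OF l rsn_node_pos[OF l m] False] by (simp add: T_def)
      then have T: "complex_of_real (1 - T) \<noteq> 0" unfolding of_real_eq_0_iff by auto
      have d: "1 + \<i> * of_real T * \<i> = complex_of_real (1 - T)" by (simp add: algebra_simps)
      have "(\<lambda>w. (sndn l w - \<i> * of_real T) / (1 + \<i> * of_real T * sndn l w)) \<midarrow>0\<rightarrow> (\<i> - \<i> * of_real T) / (1 + \<i> * of_real T * \<i>)"
        by (intro tendsto_intros s l) (use T d in simp)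
      also have "(\<i> - \<i> * of_real T) / (1 + \<i> * of_real T * \<i>) = \<i> * complex_of_real (1 - T) / complex_of_real (1 - T)"
        unfolding d by (simp add: algebra_simps)
      also have "\<dots> = \<i>" using T by simp
      finally show ?thesis using False by (simp add: mobius_def T_def)
    qed
    have "s_pullback \<midarrow>0\<rightarrow> \<i> powi (1 - int m) * (\<Prod>j=1..m. \<i>)"
      unfolding s_pullback_eq by (intro tendsto_intros mb)
    also have "\<i> powi (1 - int m) * (\<Prod>j=1..m. \<i>) = \<i> powi (1 - int m) * \<i> powi (int m)"
      by (simp add: power_int_def)
    also have "\<dots> = \<i> powi (1 - int m + int m)" by (subst power_int_add) auto
    also have "\<dots> = \<i>" by simp
    finally have "h \<midarrow>0\<rightarrow> \<i> / \<i>" unfolding h_def by (intro tendsto_divide r) auto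
    then have "h \<midarrow>0\<rightarrow> 1" by simp
    then show "c = 1" using c(1)[of 0] LIM_unique by metis
  qed
  show ?thesis
    using c(2)[of u] sndn_rescaled_nonzero[of u] by eventually_elim (use \<open>c = 1\<close> in \<open>simp add: h_def\<close>)
qed

lemma mobius_isCont:
  assumes z: "sndn l u \<noteq> 0" and n: "\<not> on_axis l (- \<tau>) u"
  shows "isCont (mobius l \<tau>) (sndn l u)"
proof (cases "axis_den l \<tau> = 0")
  case True
  then have eq: "mobius l \<tau> = (\<lambda>z. - 1 / z)" by (simp add: fun_eq_iff mobius_def)
  show ?thesis unfolding eq using z by (intro continuous_intros)
next
  case False
  define T where "T = axis_val l \<tau>"
  have den: "sndn_den l u \<noteq> 0" using z sndn_pole_value[OF l] by blast
  have "1 + \<i> * of_real T * sndn l u \<noteq> 0"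
  proof
    assume 0: "1 + \<i> * of_real T * sndn l u = 0"
    then have T0: "T \<noteq> 0" by auto
    then have "axis_den l (- \<tau>) \<noteq> 0"
      using axis_den_mult[OF l, of \<tau>] by (auto simp: T_def axis_val_def)
    moreover have "1 + \<i> * of_real T * sndn l u = \<i> * of_real T * (sndn l u - \<i> * of_real (inverse T))"
      using T0 by (simp add: field_simps)
    then have "sndn l u = \<i> * of_real (axis_val l (- \<tau>))"
      using 0 T0 by (simp add: axis_val_minus[OF l] T_def)
    ultimately show False using on_axisI_value[OF l den] n by blast
  qed
  moreover have "mobius l \<tau> = (\<lambda>z. (z - \<i> * of_real T) / (1 + \<i> * of_real T * z))"
    using False by (simp add: fun_eq_iff mobius_def T_def)
  ultimately show ?thesis by (simp only:, intro continuous_intros)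
qed

text \<open>
  Where the right side is finite and nonzero, no factor of \<open>s\<close> vanishes or blows up, so both sides are
  continuous and the identity carries over from the punctured neighbourhood. At a zero or pole one of the
  factors has a vanishing numerator or denominator, so that both sides are 0.
\<close>

lemma s_fun_sndn:
  assumes z: "sndn l u \<noteq> 0"
  shows "s_fun l m (sndn l u) = sndn lam (u / of_real M)"
proof (cases "sndn lam (u / of_real M) = 0")
  case False
  then have no: "\<not> on_axis l (- node_pos l m j) u" if "j \<in> {1..m}" for j
    using sndn_eq_0_iff_on_axis[OF lam] on_axis_nodes(2) that by blast
  have den: "sndn_den l u \<noteq> 0" "sndn_den lam (u / of_real M) \<noteq> 0"
    using z False sndn_pole_value[OF l] sndn_pole_value[OF lam] by blast+
  have "(\<lambda>w. mobius l (node_pos l m j) (sndn l w)) \<midarrow>u\<rightarrow> mobius l (node_pos l m j) (sndn l u)" if "j \<in> {1..m}" for j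
    using mobius_isCont[OF z no[OF that]] sndn_tendsto[OF l den(1)] by (rule isCont_tendsto_compose)
  then have "s_pullback \<midarrow>u\<rightarrow> s_pullback u"
    unfolding s_pullback_eq by (intro tendsto_intros) auto
  moreover have "sndn_rescaled \<midarrow>u\<rightarrow> sndn_rescaled u"
  proof -
    have "isCont (sndn lam) (u / of_real M)" using sndn_tendsto[OF lam den(2)] by (simp add: isCont_def)
    moreover have "(\<lambda>w. w / of_real M) \<midarrow>u\<rightarrow> u / of_real M" using M_pos by (intro tendsto_intros) auto
    ultimately show ?thesis unfolding sndn_rescaled_def by (rule isCont_tendsto_compose)
  qed
  then have "s_pullback \<midarrow>u\<rightarrow> sndn_rescaled u"
    using Lim_transform_eventually[OF _ eventually_mono[OF s_pullback_eq_rhs_eventually[of u]], of sndn_rescaled] by simp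
  ultimately have "s_pullback u = sndn_rescaled u" by (rule LIM_unique)
  then show ?thesis by (simp add: s_pullback_def sndn_rescaled_def)
next
  case True
  then obtain j where j: "j \<in> {1..m}" "on_axis l (node_pos l m j) u \<or> on_axis l (- node_pos l m j) u"
    using sndn_eq_0_iff_on_axis[OF lam] on_axis_nodes by blast
  define \<tau> where "\<tau> = node_pos l m j"
  have den: "sndn_den l u \<noteq> 0" using z sndn_pole_value[OF l] by blast
  have "mobius l \<tau> (sndn l u) = 0"
    using j(2)[folded \<tau>_def]
  proof
    assume ax: "on_axis l \<tau> u"
    then show ?thesis using on_axisD[OF l ax] den by (simp add: mobius_def)
  next
    assume ax: "on_axis l (- \<tau>) u"
    have v: "sndn l u = \<i> * of_real (inverse (axis_val l \<tau>))"
      using on_axisD(2)[OF l ax] by (simp add: axis_val_minus[OF l])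
    then have "axis_val l \<tau> \<noteq> 0" using z by auto
    then have "axis_den l \<tau> \<noteq> 0" "1 + \<i> * of_real (axis_val l \<tau>) * sndn l u = 0"
      unfolding v by (auto simp: axis_val_def)
    then show ?thesis by (simp add: mobius_def)
  qed
  then have "s_fun l m (sndn l u) = 0"
    unfolding s_fun_eq_mobius[OF l] using j(1) by (auto simp: \<tau>_def intro!: bexI[of _ j])
  then show ?thesis using True by simp
qed

end

text \<open>
  If \<open>z\<close> were omitted, \<open>1/(sndn k u - z)\<close> would be constant by Liouville's theorem. It tends to 0 at the pole \<open>iK'\<close>
  but not at the regular point 0.
\<close>

lemma sndn_surj:
  assumes k: "0 < k" "k < 1" and z: "z \<noteq> 0"
  obtains u where "sndn k u = z"
proof -
  have "\<exists>u. sndn k u = z"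
  proof (rule ccontr)
    assume "\<not> (\<exists>u. sndn k u = z)"
    then have ne: "sndn k u - z \<noteq> 0" for u by simp
    define f where "f = (\<lambda>u. inverse (sndn k u - z))"
    have pole: "f \<midarrow>u\<rightarrow> 0" if "sndn_den k u = 0" for u
    proof -
      have "filterlim (\<lambda>u. sndn k u + (- z)) at_infinity (at u)"
        using sndn_is_pole[OF k that] unfolding is_pole_def
        by (rule tendsto_add_filterlim_at_infinity'[OF _ tendsto_const])
      then show ?thesis
        unfolding f_def by (intro filterlim_compose[OF tendsto_inverse_0]) simp
    qed
    have fin: "f \<midarrow>u\<rightarrow> f u" if "sndn_den k u \<noteq> 0" for u
      unfolding f_def by (intro tendsto_intros sndn_tendsto[OF k that] ne)
    have mero: "f meromorphic_on UNIV"
      unfolding f_def by (intro meromorphic_intros sndn_meromorphic[OF k])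
    have lim: "\<exists>c. f \<midarrow>u\<rightarrow> c" for u using pole fin by blast
    have pos: "4 * ellipK k > 0" "4 * ellipK (compl_mod k) > 0"
      using ellipK_pos k compl_mod_pos[OF k] by auto
    have "f (u + of_real (4 * ellipK k)) = f u" "f (u + \<i> * of_real (4 * ellipK (compl_mod k))) = f u" for u
      using sndn_periodic[OF k, of u] by (simp_all add: f_def mult_ac)
    then obtain c where c: "\<And>u. f \<midarrow>u\<rightarrow> c"
      using doubly_periodic_Liouville[OF mero lim pos] by metis
    have "sndn_den k (Complex 0 (ellipK (compl_mod k))) = 0"
      using axis_den_K[OF k] k by (simp add: sndn_den_def axis_den_def)
    from pole[OF this] have "c = 0" using c LIM_unique by blast
    moreover have "sndn_den k 0 \<noteq> 0" using k compl_mod_pos[OF k] by (simp add: sndn_den_def)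
    from fin[OF this] have "c = f 0" using c LIM_unique by blast
    ultimately show False using ne[of 0] by (simp add: f_def)
  qed
  then show ?thesis using that by blast
qed

lemma sndn_shift_iK'_mult:
  assumes k: "0 < k" "k < 1"
  shows "sndn k (z + of_nat n * (2 * \<i> * of_real (ellipK (compl_mod k)))) =
    (if even n then sndn k z else inverse (sndn k z))"
proof (induction n)
  case (Suc n)
  have "z + of_nat (Suc n) * (2 * \<i> * of_real (ellipK (compl_mod k))) =
    (z + of_nat n * (2 * \<i> * of_real (ellipK (compl_mod k)))) + 2 * \<i> * of_real (ellipK (compl_mod k))"
    by (simp add: algebra_simps)
  then have "sndn k (z + of_nat (Suc n) * (2 * \<i> * of_real (ellipK (compl_mod k)))) =
     inverse (sndn k (z + of_nat n * (2 * \<i> * of_real (ellipK (compl_mod k)))))"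
    by (simp only: sndn_shift_iK'[OF k])
  then show ?case using Suc by simp
qed simp

section \<open>Return to the variable \<open>z\<close>\<close>

lemma joukowski_eq_imp:
  assumes "z \<noteq> 0" "w \<noteq> 0" "w + inverse w = z + inverse z"
  shows "w = z \<or> w = inverse (z::complex)"
proof -
  have "(w - z) * (w * z - 1) = 0"
    using assms by (simp add: field_simps)
  then have "w = z \<or> z * w = 1" by (auto simp: mult.commute)
  then show ?thesis using inverse_unique[of z w] by auto
qed

lemma Im_minus_inverse:
  assumes "z \<noteq> 0"
  shows "Im (z - inverse z) = Im z * (1 + inverse ((norm z)\<^sup>2))"
  by (simp add: cmod_power2 algebra_simps divide_inverse)

lemma Re_dn_sign:
  assumes "z \<noteq> 0"
  shows "0 \<le> Re ((z - inverse z) / (2 * \<i>)) \<longleftrightarrow> 0 \<le> Im z"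
proof -
  have "Re (x / (2 * \<i>)) = Im x / 2" for x
    by (simp add: Re_divide)
  then have "Re ((z - inverse z) / (2 * \<i>)) = Im (z - inverse z) / 2" .
  also have "0 \<le> \<dots> \<longleftrightarrow> 0 \<le> Im z"
  proof -
    have "0 < 1 + inverse ((norm z)\<^sup>2)" by (simp add: add_pos_nonneg)
    then show ?thesis unfolding Im_minus_inverse[OF assms] by (simp add: zero_le_mult_iff)
  qed
  finally show ?thesis .
qed

text \<open>
  The conditions on \<open>sn\<close> and \<open>dn\<close> say that \<open>w = sndn l u\<close> satisfies \<open>w + 1/w = z + 1/z\<close> and that the real part of
  \<open>(w - 1/w)/(2i)\<close>, which has the sign of \<open>Im w\<close>, is nonnegative.
\<close>

lemma is_arc_sn_iff:
  assumes l: "0 < l" "l < 1" and z: "z \<noteq> 0"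
  shows "is_arc_sn l (joukowski z) u \<longleftrightarrow>
    (sndn l u = z \<or> sndn l u = inverse z) \<and> 0 \<le> Im (sndn l u)"
proof -
  define w where "w = sndn l u"
  have "is_arc_sn l (joukowski z) u \<longleftrightarrow> w \<noteq> 0 \<and> w + inverse w = z + inverse z \<and>
    ((w - inverse w) / (2 * \<i>))\<^sup>2 = 1 - (joukowski z)\<^sup>2 \<and> 0 \<le> Re ((w - inverse w) / (2 * \<i>))"
    unfolding is_arc_sn_def is_pole_jacobi_sn_iff[OF l] jacobi_sn_eq[OF l] jacobi_dn_eq[OF l] w_def joukowski_def
    using l by (auto simp: field_simps)
  also have "\<dots> \<longleftrightarrow> w \<noteq> 0 \<and> w + inverse w = z + inverse z \<and> 0 \<le> Im w"
  proof (cases "w \<noteq> 0 \<and> w + inverse w = z + inverse z")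
    case True
    have "w * inverse w = 1" using True by simp
    then have "(w - inverse w)\<^sup>2 = (w + inverse w)\<^sup>2 - 4" by algebra
    then have "((w - inverse w) / (2 * \<i>))\<^sup>2 = 1 - ((w + inverse w) / 2)\<^sup>2"
      by (simp add: power_divide power_mult_distrib diff_divide_distrib)
    then show ?thesis using True Re_dn_sign[of w] by (simp add: joukowski_def)
  qed auto
  also have "\<dots> \<longleftrightarrow> (w = z \<or> w = inverse z) \<and> 0 \<le> Im w"
    using joukowski_eq_imp[OF z, of w] z by auto
  finally show ?thesis by (simp add: w_def)
qed

lemma ex_joukowski: "\<exists>z. z \<noteq> 0 \<and> joukowski z = x"
proof -
  define r where "r = csqrt (x\<^sup>2 - 1)"
  have r: "r * r = x\<^sup>2 - 1" by (metis r_def power2_csqrt power2_eq_square)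
  have p: "(x + r) * (x - r) = 1" using r by (simp add: algebra_simps power2_eq_square)
  then have "inverse (x + r) = x - r" by (metis inverse_unique)
  then show ?thesis using p by (intro exI[of _ "x + r"]) (auto simp: joukowski_def)
qed

lemma ex_is_arc_sn:
  assumes l: "0 < l" "l < 1"
  shows "\<exists>u. is_arc_sn l x u"
proof -
  obtain z where z: "z \<noteq> 0" "joukowski z = x" using ex_joukowski by blast
  define w where "w = (if 0 \<le> Im z then z else inverse z)"
  have "w \<noteq> 0" "w = z \<or> w = inverse z" using z by (auto simp: w_def)
  moreover have "0 \<le> Im w" by (auto simp: w_def divide_nonpos_nonneg)
  moreover obtain u where "sndn l u = w" using sndn_surj[OF l \<open>w \<noteq> 0\<close>] by blast
  ultimately show ?thesis using is_arc_sn_iff[OF l z(1), of u] z(2) by auto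
qed

context transformation
begin

text \<open>
  The point \<open>1/z\<close> is reached by shifting \<open>u\<close> by \<open>2iK(\<ell>')\<close>. On the other side this is \<open>m\<close> times the shift
  that inverts \<open>sndn lam\<close>.
\<close>

lemma s_fun_inverse:
  assumes z: "z \<noteq> 0"
  shows "s_fun l m (inverse z) = (if even m then s_fun l m z else inverse (s_fun l m z))"
proof -
  obtain u where u: "sndn l u = z" using sndn_surj[OF l z] by blast
  define v where "v = u + 2 * \<i> * of_real (ellipK (compl_mod l))"
  have v: "sndn l v = inverse z" unfolding v_def by (simp add: sndn_shift_iK'[OF l] u)
  have "v / of_real M = u / of_real M + 2 * \<i> * of_real (ellipK (compl_mod l) / M)"
    by (simp add: v_def add_divide_distrib)
  also have "\<dots> = u / of_real M + of_nat m * (2 * \<i> * of_real (ellipK (compl_mod lam)))"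
    unfolding compl_period by simp
  finally have "sndn lam (v / of_real M) = (if even m then sndn lam (u / of_real M) else inverse (sndn lam (u / of_real M)))"
    by (simp only: sndn_shift_iK'_mult[OF lam])
  then show ?thesis
    using s_fun_sndn[of u] s_fun_sndn[of v] z u v by simp
qed

text \<open>
  Everything is expressed by \<open>s(z)\<close>, so it does not depend on the choice of \<open>u\<close>. The last but one claim is
  needed since \<open>sign_pow m z\<close> is 0 for odd \<open>m\<close> and \<open>z = \<plusminus>1\<close>; there \<open>s(z) = 1/s(z)\<close>.
\<close>

lemma sn_dn_at_arc:
  assumes z: "z \<noteq> 0" "even m \<or> Im z \<noteq> 0 \<or> z = 1 \<or> z = - 1" and u: "is_arc_sn l (joukowski z) u"
  shows "of_real lam * jacobi_sn lam (u / of_real M) = (s_fun l m z + inverse (s_fun l m z)) / 2"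
    and "jacobi_dn lam (u / of_real M) = sign_pow m z * (s_fun l m z - inverse (s_fun l m z)) / (2 * \<i>)"
    and "sign_pow m z * sign_pow m z * (s_fun l m z - inverse (s_fun l m z)) = s_fun l m z - inverse (s_fun l m z)"
    and "is_pole (jacobi_sn lam) (u / of_real M) \<longleftrightarrow> s_fun l m z = 0"
proof -
  define W where "W = sndn lam (u / of_real M)"
  define S where "S = s_fun l m z"
  have w: "sndn l u = z \<or> sndn l u = inverse z" "0 \<le> Im (sndn l u)"
    using is_arc_sn_iff[OF l z(1)] u by auto
  then have W: "W = s_fun l m (sndn l u)" using s_fun_sndn[of u] z(1) by (auto simp: W_def)
  have sn: "of_real lam * jacobi_sn lam (u / of_real M) = (W + inverse W) / 2"
    using lam by (simp add: jacobi_sn_eq[OF lam] W_def)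
  have dn: "jacobi_dn lam (u / of_real M) = (W - inverse W) / (2 * \<i>)"
    by (simp add: jacobi_dn_eq[OF lam] W_def)
  have im: "Im (inverse z) < 0" if "Im z > 0" using that
    by (auto simp: divide_neg_pos sum_power2_gt_zero_iff)
  have "W + inverse W = S + inverse S \<and> W - inverse W = sign_pow m z * (S - inverse S) \<and>
     sign_pow m z * sign_pow m z * (S - inverse S) = S - inverse S \<and> (W = 0 \<longleftrightarrow> S = 0)"
  proof (cases "even m")
    case True
    then have "W = S" using w s_fun_inverse[OF z(1)] by (auto simp: W S_def)
    then show ?thesis using True by (simp add: sign_pow_def)
  next
    case odd: False
    consider "Im z > 0" | "Im z < 0" | "z = 1 \<or> z = - 1" using z(2) odd by linarith
    then show ?thesis
    proof cases
      case 1
      then have "W = S" using w im by (auto simp: W S_def)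
      then show ?thesis using odd 1 by (simp add: sign_pow_def)
    next
      case 2
      then have "sndn l u = inverse z" using w by auto
      then have "W = inverse S" using s_fun_inverse[OF z(1)] odd by (simp add: W S_def)
      then show ?thesis using odd 2 by (simp add: sign_pow_def)
    next
      case 3
      then have "inverse z = z" by auto
      then have "S = inverse S" "W = S" using s_fun_inverse[OF z(1)] odd w by (auto simp: W S_def)
      then show ?thesis by simp
    qed
  qed
  then show "of_real lam * jacobi_sn lam (u / of_real M) = (s_fun l m z + inverse (s_fun l m z)) / 2"
    "jacobi_dn lam (u / of_real M) = sign_pow m z * (s_fun l m z - inverse (s_fun l m z)) / (2 * \<i>)"
    "sign_pow m z * sign_pow m z * (s_fun l m z - inverse (s_fun l m z)) = s_fun l m z - inverse (s_fun l m z)"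
    "is_pole (jacobi_sn lam) (u / of_real M) \<longleftrightarrow> s_fun l m z = 0"
    unfolding sn dn is_pole_jacobi_sn_iff[OF lam] by (simp_all add: W_def[symmetric] S_def[symmetric])
qed

lemma is_arc_sn_arc_sn: "is_arc_sn l x (arc_sn l x)"
  unfolding arc_sn_def by (rule someI_ex[OF ex_is_arc_sn[OF l]])

lemma s_fun_eq_F_G:
  assumes z: "z \<noteq> 0" "even m \<or> Im z \<noteq> 0 \<or> z = 1 \<or> z = - 1"
  shows "s_fun l m z = F_fun l lam M (joukowski z) + \<i> * sign_pow m z * G_fun l lam M (joukowski z)"
proof -
  note * = sn_dn_at_arc[OF z is_arc_sn_arc_sn]
  define S where "S = s_fun l m z"
  have "F_fun l lam M (joukowski z) + \<i> * sign_pow m z * G_fun l lam M (joukowski z) =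
     (S + inverse S) / 2 + sign_pow m z * sign_pow m z * (S - inverse S) / 2"
  proof -
    have "\<i> * a * (a * b / (2 * \<i>)) = a * a * b / 2" for a b by (simp add: algebra_simps)
    then show ?thesis unfolding F_fun_def G_fun_def *(1,2) S_def by (simp only:)
  qed
  also have "\<dots> = (S + inverse S) / 2 + (S - inverse S) / 2"
    using *(3) by (simp add: S_def)
  also have "\<dots> = S" by (simp add: field_simps)
  finally show ?thesis by (simp add: S_def)
qed

lemma s_fun_nonzero_on_circle:
  assumes "norm z = 1"
  shows "s_fun l m z \<noteq> 0"
  unfolding s_fun_eq_mobius[OF l] using mobius_nonzero_on_circle[OF l rsn_node_pos[OF l m] assms] by simp

lemma s_fun_meromorphic: "s_fun l m meromorphic_on A"
  unfolding s_fun_eq_mobius[OF l, abs_def] by (intro meromorphic_intros mobius_meromorphic)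

lemma F_G_eventually:
  assumes w: "w \<in> (if even m then UNIV else {z. Im z \<noteq> 0})"
  shows "eventually (\<lambda>z. s_fun l m z = F_fun l lam M (joukowski z) + \<i> * sign_pow m z * G_fun l lam M (joukowski z)) (at w)"
proof -
  have "open (if even m then UNIV else {z. Im z \<noteq> 0})"
    by (auto intro!: open_Collect_neq continuous_intros)
  then have "eventually (\<lambda>z. z \<in> (if even m then UNIV else {z. Im z \<noteq> 0})) (at w)"
    using w by (intro eventually_at_in_open')
  moreover have "eventually (\<lambda>z. z \<noteq> 0) (at w)" by (rule eventually_neq_at_within)
  ultimately show ?thesis
    by eventually_elim (rule s_fun_eq_F_G, auto split: if_splits)
qed

lemma F_G_meromorphic:
  "(\<lambda>z. F_fun l lam M (joukowski z) + \<i> * sign_pow m z * G_fun l lam M (joukowski z))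
     meromorphic_on (if even m then UNIV else {z. Im z \<noteq> 0})"
  by (rule iffD1[OF meromorphic_on_cong[OF F_G_eventually refl] s_fun_meromorphic])

end

theorem theorem2p4:
  fixes \<Theta> l :: real and m :: nat
  assumes "0 < \<Theta>" and "\<Theta> < pi / 2"
    and "l = cos \<Theta>"
    and "m \<ge> 1"
  shows "(\<exists>!lam. modulus_eq l m lam) \<and>
    (\<forall>lam M. modulus_eq l m lam \<longrightarrow> M = ellipK l / ellipK lam \<longrightarrow>
      (\<forall>x. \<exists>u. is_arc_sn l x u) \<and>
      (\<forall>z. z \<noteq> 0 \<and> (even m \<or> Im z \<noteq> 0 \<or> z = 1 \<or> z = -1) \<longrightarrow>
         (\<forall>u. is_arc_sn l (joukowski z) u \<longrightarrow>
            of_real lam * jacobi_sn lam (u / of_real M) = F_fun l lam M (joukowski z) \<and>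
            jacobi_dn lam (u / of_real M) = G_fun l lam M (joukowski z)) \<and>
         (\<not> is_pole (jacobi_sn lam) (arc_sn l (joukowski z) / of_real M) \<longrightarrow>
            s_fun l m z =
              F_fun l lam M (joukowski z) + \<i> * sign_pow m z * G_fun l lam M (joukowski z)) \<and>
         (norm z = 1 \<longrightarrow> \<not> is_pole (jacobi_sn lam) (arc_sn l (joukowski z) / of_real M)) \<and>
         (odd m \<and> (z = 1 \<or> z = -1) \<longrightarrow> G_fun l lam M (joukowski z) = 0)) \<and>
      (let D = (if even m then UNIV else {z. Im z \<noteq> 0});
           rhs = (\<lambda>z. F_fun l lam M (joukowski z) +
                      \<i> * sign_pow m z * G_fun l lam M (joukowski z))
       in s_fun l m meromorphic_on D \<and> rhs meromorphic_on D \<and>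
          (\<forall>w\<in>D. \<forall>\<^sub>F z in at w. s_fun l m z = rhs z)))"
proof -
  have "0 < cos \<Theta>" using assms by (intro cos_gt_zero) auto
  moreover have "cos \<Theta> < cos 0" using assms by (intro cos_monotone_0_pi) auto
  ultimately have l: "0 < l" "l < 1" using assms(3) by auto
  show ?thesis
  proof (intro conjI allI impI)
    show "\<exists>!lam. modulus_eq l m lam" by (rule ex1_modulus_eq[OF l assms(4)])
  next
    fix x show "\<exists>u. is_arc_sn l x u" by (rule ex_is_arc_sn[OF l])
  next
    fix lam M assume "modulus_eq l m lam" "M = ellipK l / ellipK lam"
    then interpret transformation l lam M m
      using l assms(4) by unfold_locales
    {
      fix z :: complex
      assume z: "z \<noteq> 0 \<and> (even m \<or> Im z \<noteq> 0 \<or> z = 1 \<or> z = - 1)"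
      note arc = sn_dn_at_arc[OF conjunct1[OF z] conjunct2[OF z]]
      note arc' = arc[OF is_arc_sn_arc_sn]
      fix u assume u: "is_arc_sn l (joukowski z) u"
      show "of_real lam * jacobi_sn lam (u / of_real M) = F_fun l lam M (joukowski z)"
        unfolding F_fun_def arc(1)[OF u] arc'(1) ..
      show "jacobi_dn lam (u / of_real M) = G_fun l lam M (joukowski z)"
        unfolding G_fun_def arc(2)[OF u] arc'(2) ..
    }
    {
      fix z :: complex
      assume z: "z \<noteq> 0 \<and> (even m \<or> Im z \<noteq> 0 \<or> z = 1 \<or> z = - 1)"
      note arc' = sn_dn_at_arc[OF conjunct1[OF z] conjunct2[OF z] is_arc_sn_arc_sn]
      show "s_fun l m z = F_fun l lam M (joukowski z) + \<i> * sign_pow m z * G_fun l lam M (joukowski z)"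
        using s_fun_eq_F_G z by blast
      show "\<not> is_pole (jacobi_sn lam) (arc_sn l (joukowski z) / of_real M)" if "norm z = 1"
        unfolding arc'(4) using s_fun_nonzero_on_circle[OF that] by simp
      show "G_fun l lam M (joukowski z) = 0" if "odd m \<and> (z = 1 \<or> z = - 1)"
        unfolding G_fun_def arc'(2) using that m by (auto simp: sign_pow_def)
    }
    show "let D = (if even m then UNIV else {z. Im z \<noteq> 0});
           rhs = (\<lambda>z. F_fun l lam M (joukowski z) + \<i> * sign_pow m z * G_fun l lam M (joukowski z))
       in s_fun l m meromorphic_on D \<and> rhs meromorphic_on D \<and>
          (\<forall>w\<in>D. \<forall>\<^sub>F z in at w. s_fun l m z = rhs z)"
      unfolding Let_def using s_fun_meromorphic F_G_meromorphic F_G_eventually by blast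
  qed
qed

end
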